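(* Let $\mathcal X$ be a $GC_3$ set and let $\ell$ be a $3$-node line of $\mathcal X$. Then $$|\mathcal X_\ell|=3,\quad 1,\quad\text{or}\quad 0.$$ Moreover, the following hold: (i) $|\mathcal X_\ell|=3$ if and only if there is a maximal line $M_0$ of $\mathcal X$ such that $M_0\cap\ell\cap\mathcal X=\emptyset$. In this case $\mathcal X_\ell=\mathcal X\setminus(\ell\cup M_0)$; hence $\mathcal X_\ell$ is a $GC_1$ set. All other maximal lines $M$, $M\ne M_0$, intersect the line $\ell$ at a node of $\mathcal X$ and satisfy $|M\cap\mathcal X_\ell|=2$. (ii) $|\mathcal X_\ell|=1$ if and only if there are two distinct maximal lines $M',M''$ of $\mathcal X$ such that the point $M'\cap M''$ lies on $\ell$ and belongs to $\mathcal X$ (written $M'\cap M''\cap\ell\in\mathcal X$). In this case $\mathcal X_\ell=\mathcal X\setminus(\ell\cup M'\cup M'')$. (iii) $|\mathcal X_\ell|=0$ if and only if there are exactly three maximal lines in $\mathcal X$ and they intersect $\ell$ at three distinct nodes of $\mathcal X$. Furthermore, if the node set $\mathcal X$ possesses exactly three maximal lines, then any $3$-node line $\ell$ is used either by exactly three nodes or is not used at all: $$|\mathcal X_\ell|=3\quad\text{or}\quad 0.$$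
   Context: $\Pi_n$ denotes the space of real bivariate polynomials of total degree at most $n$; $\dim\Pi_n=\binom{n+2}{2}$. A finite set $\mathcal X$ of distinct points (nodes) in the plane is $n$-poised if for arbitrary prescribed values at the nodes there is a unique $p\in\Pi_n$ taking these values; then $|\mathcal X|=\binom{n+2}{2}$. For an $n$-poised set $\mathcal X$ and $A\in\mathcal X$, the ($n$-)fundamental polynomial $p_A^\star\in\Pi_n$ is the one equal to $1$ at $A$ and $0$ at all other nodes. An $n$-poised set is a $GC_n$ set if the fundamental polynomial of each of its nodes is a product of $n$ linear factors (polynomials of degree one). A line is identified with a degree-one polynomial defining it. A node $A\in\mathcal X$ uses a line $\ell$ if $p_A^\star=\ell q$ for some $q\in\Pi_{n-1}$. A $k$-node line is a line passing through exactly $k$ nodes of $\mathcal X$; a maximal line of an $n$-poised (in particular $GC_n$) set is an $(n+1)$-node line (so a $4$-node line when $n=3$). $\mathcal X_\ell$ denotes the set of nodes of $\mathcal X$ which use the line $\ell$. *)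

theory Defs
  imports Complex_Main
begin

type_synonym point = "real \<times> real"

text \<open>
  The space of real bivariate polynomials of total degree at most \<open>n\<close>. Polynomials are
  represented by the functions they induce on the plane; as the reals are an infinite field, this
  representation is faithful, and the product of polynomials is the pointwise product.
\<close>

definition bipoly :: "nat \<Rightarrow> (point \<Rightarrow> real) set" where
  "bipoly n = {p. \<exists>c :: nat \<Rightarrow> nat \<Rightarrow> real.
     p = (\<lambda>(x, y). \<Sum>i\<le>n. \<Sum>j\<le>n - i. c i j * x ^ i * y ^ j)}"

definition linear_polys :: "(point \<Rightarrow> real) set" where
  "linear_polys = bipoly 1 - bipoly 0"

definition poised :: "nat \<Rightarrow> point set \<Rightarrow> bool" where
  "poised n X \<longleftrightarrow> finite X \<and> (\<forall>v :: point \<Rightarrow> real. \<exists>!p. p \<in> bipoly n \<and> (\<forall>A\<in>X. p A = v A))"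

text \<open>Meaningful for \<open>n\<close>-poised \<open>X\<close> and \<open>A \<in> X\<close>, where the described polynomial exists
  and is unique.\<close>

definition fundamental_poly :: "nat \<Rightarrow> point set \<Rightarrow> point \<Rightarrow> (point \<Rightarrow> real)" where
  "fundamental_poly n X A = (THE p. p \<in> bipoly n \<and> p A = 1 \<and> (\<forall>B\<in>X - {A}. p B = 0))"

definition GC :: "nat \<Rightarrow> point set \<Rightarrow> bool" where
  "GC n X \<longleftrightarrow> poised n X \<and>
     (\<forall>A\<in>X. \<exists>l :: nat \<Rightarrow> point \<Rightarrow> real.
        (\<forall>i<n. l i \<in> linear_polys) \<and> fundamental_poly n X A = (\<lambda>z. \<Prod>i<n. l i z))"

text \<open>
  Lines are point sets, namely the zero sets of polynomials of degree one. The defining polynomial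
  of a line is unique up to a nonzero constant factor, so the choice of \<open>l\<close> in \<open>uses\<close>
  is immaterial.
\<close>

definition zero_set :: "(point \<Rightarrow> real) \<Rightarrow> point set" where
  "zero_set p = {z. p z = 0}"

definition is_line :: "point set \<Rightarrow> bool" where
  "is_line L \<longleftrightarrow> (\<exists>l\<in>linear_polys. L = zero_set l)"

definition uses :: "nat \<Rightarrow> point set \<Rightarrow> point \<Rightarrow> point set \<Rightarrow> bool" where
  "uses n X A L \<longleftrightarrow>
     (\<exists>l\<in>linear_polys. L = zero_set l \<and>
        (\<exists>q\<in>bipoly (n - 1). fundamental_poly n X A = (\<lambda>z. l z * q z)))"

definition using_nodes :: "nat \<Rightarrow> point set \<Rightarrow> point set \<Rightarrow> point set" where
  "using_nodes n X L = {A \<in> X. uses n X A L}"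

definition node_line :: "nat \<Rightarrow> point set \<Rightarrow> point set \<Rightarrow> bool" where
  "node_line k X L \<longleftrightarrow> is_line L \<and> card (L \<inter> X) = k"

definition maximal_line :: "nat \<Rightarrow> point set \<Rightarrow> point set \<Rightarrow> bool" where
  "maximal_line n X M \<longleftrightarrow> node_line (n + 1) X M"

end

theory Submission
  imports Defs
begin

text \<open>
  A node \<open>A\<close> of a \<open>GC\<^sub>3\<close> set \<open>X\<close> uses a line \<open>L\<close> if and only if \<open>L\<close> and two further lines cover
  exactly \<open>X - {A}\<close>. This makes the problem purely combinatorial: \<open>X\<close> has 10 nodes, no three lines
  cover \<open>X\<close>, and every node is the only one missed by some three lines. Then a line has at most 4
  nodes, a maximal line is used by every node off it, two maximal lines meet at a node, and no three
  are concurrent. Counting shows that there are at least three maximal lines, so either some maximal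
  line misses \<open>L\<close>, or two of them meet on \<open>L\<close>, or exactly three exist and they meet \<open>L\<close> at
  distinct nodes. These cases give 3, 1 and 0 users of \<open>L\<close>. When there are exactly three maximal
  lines, exactly one node \<open>Z\<close> lies off all of them, and the six other non-vertex nodes are paired by
  three lines through \<open>Z\<close>; this structure settles the last case and the final claim.
\<close>

section \<open>Combinatorics of covering lines\<close>

text \<open>\<open>not_covered\<close> carries the uniqueness half of poisedness: three lines
  through all nodes would give a nonzero cubic vanishing on \<open>X\<close>.
  \<open>covered_except\<close> is the \<open>GC\<close> condition, its lines being the zero sets of
  the factors of a fundamental polynomial, and 10 is the dimension of the space of cubics. Lines may
  be parallel, so each common node of two lines has to be forced by counting. The recurring device:
  a set of nodes on a line that is covered by k other lines has at most k elements, so a line with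
  more nodes in that set is itself one of the covering lines. The main obstacle is the existence of
  three maximal lines. Nothing is known at the start, and each maximal line that is found shrinks
  the set left to two or fewer free lines, so the first, second and third one need different counts.
  The three cases for the line \<open>L\<close> exclude each other because they give different
  numbers of users; this turns three implications into equivalences.\<close>

locale line_cover =
  fixes line :: "'a set \<Rightarrow> bool" and X :: "'a set"
  assumes line_through: "\<exists>K. line K \<and> p \<in> K \<and> q \<in> K"
    and line_unique: "\<lbrakk>line K; line L; p \<in> K; p \<in> L; q \<in> K; q \<in> L; p \<noteq> q\<rbrakk> \<Longrightarrow> K = L"
    and card_X: "card X = 10"
    and not_covered: "\<lbrakk>line K; line L; line M\<rbrakk> \<Longrightarrow> \<not> X \<subseteq> K \<union> L \<union> M"
    and covered_except: "A \<in> X \<Longrightarrow> \<exists>K L M. line K \<and> line L \<and> line M \<and> X - (K \<union> L \<union> M) = {A}"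
begin

definition missing :: "'a \<Rightarrow> 'a set \<Rightarrow> 'a set \<Rightarrow> 'a set \<Rightarrow> bool" where
  "missing A K L M \<longleftrightarrow> line K \<and> line L \<and> line M \<and> X - (K \<union> L \<union> M) = {A}"

definition used :: "'a \<Rightarrow> 'a set \<Rightarrow> bool" where
  "used A K \<longleftrightarrow> (\<exists>L M. missing A K L M)"

definition maxl :: "'a set \<Rightarrow> bool" where
  "maxl M \<longleftrightarrow> line M \<and> card (M \<inter> X) = 4"

lemma finite_X [simp, intro]: "finite X"
  using card_X card.infinite by fastforce

lemma finite_sub [simp]: "finite (K \<inter> X)" "finite (X \<inter> K)" "finite (X - K)" "finite (K \<inter> X - L)"
  by auto

lemma maxl_line: "maxl M \<Longrightarrow> line M"
  by (simp add: maxl_def)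

text \<open>These two transpositions generate all permutations of the three lines, so any line of a
  triple can be brought to any position.\<close>

lemma missing_swap: "missing A K L M \<Longrightarrow> missing A L K M" "missing A K L M \<Longrightarrow> missing A K M L"
  by (auto simp: missing_def)

lemma missing_lines: "missing A K L M \<Longrightarrow> line K" "missing A K L M \<Longrightarrow> line L" "missing A K L M \<Longrightarrow> line M"
  by (auto simp: missing_def)

lemma missing_node: "missing A K L M \<Longrightarrow> A \<in> X \<and> A \<notin> K \<and> A \<notin> L \<and> A \<notin> M"
  unfolding missing_def by blast

lemma missing_covers: "\<lbrakk>missing A K L M; B \<in> X; B \<noteq> A\<rbrakk> \<Longrightarrow> B \<in> K \<or> B \<in> L \<or> B \<in> M"
  unfolding missing_def by blast

lemma missing_obtain:
  assumes "A \<in> X" obtains K L M where "missing A K L M"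
  using covered_except[OF assms] unfolding missing_def by blast

section \<open>Covering bounds and elementary properties of maximal lines\<close>

text \<open>Used mostly in contrapositive form: two nodes common to \<open>K\<close> and
  \<open>L\<close> force \<open>K = L\<close>. An infinite \<open>S\<close> satisfies the bound
  because its \<open>card\<close> is 0 by convention.\<close>

lemma card_inter_le:
  assumes "line K" "line L" "K \<noteq> L" "S \<subseteq> K" "S \<subseteq> L"
  shows "card S \<le> 1"
proof (cases "finite S")
  case True
  have "x = y" if "x \<in> S" "y \<in> S" for x y
    using that assms line_unique by blast
  then show ?thesis using True by (simp add: card_le_Suc0_iff_eq)
qed simp

text \<open>Each covering line differs from \<open>M\<close> and so takes at most one point of
  \<open>S\<close>.\<close>

lemma card_cover_two:
  assumes "line M" "line K" "line L" "K \<noteq> M" "L \<noteq> M" "S \<subseteq> M" "S \<subseteq> K \<union> L"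
  shows "card S \<le> 2"
proof -
  have "card (S \<inter> K) \<le> 1" "card (S \<inter> L) \<le> 1"
    using card_inter_le[of K M] card_inter_le[of L M] assms by (meson Int_lower1 Int_lower2 order_trans)+
  moreover have "(S \<inter> K) \<union> (S \<inter> L) = S" using assms by blast
  ultimately show ?thesis using card_Un_le[of "S \<inter> K" "S \<inter> L"] by simp
qed

lemma card_cover_three:
  assumes "line M" "line K" "line L" "line N" "K \<noteq> M" "L \<noteq> M" "N \<noteq> M" "S \<subseteq> M" "S \<subseteq> K \<union> L \<union> N"
  shows "card S \<le> 3"
proof -
  have "card (S \<inter> (K \<union> L)) \<le> 2" "card (S \<inter> N) \<le> 1"
    using card_cover_two[of M K L "S \<inter> (K \<union> L)"] card_inter_le[of N M "S \<inter> N"] assms by auto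
  moreover have "(S \<inter> (K \<union> L)) \<union> (S \<inter> N) = S" using assms by blast
  ultimately show ?thesis using card_Un_le[of "S \<inter> (K \<union> L)" "S \<inter> N"] by simp
qed

text \<open>Take a node \<open>A\<close> on \<open>K\<close>. The three lines missing
  \<open>A\<close> all differ from \<open>K\<close>, so they take at most three of the other nodes
  of \<open>K\<close>.\<close>

lemma card_line_le:
  assumes "line K" shows "card (K \<inter> X) \<le> 4"
proof (rule ccontr)
  assume *: "\<not> ?thesis"
  then have "K \<inter> X \<noteq> {}" by auto
  then obtain A where A: "A \<in> K \<inter> X" by blast
  then obtain K1 K2 K3 where m: "missing A K1 K2 K3" using missing_obtain by blast
  have "card (K \<inter> X - {A}) \<le> 3"
    by (rule card_cover_three[of K K1 K2 K3]) (use assms m A in \<open>auto simp: missing_def\<close>)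
  then show False using * A by simp
qed

text \<open>Three lines other than \<open>M\<close> take at most three of its four nodes.\<close>

lemma maxl_in_missing:
  assumes "maxl M" "A \<notin> M" "missing A K1 K2 K3"
  shows "M = K1 \<or> M = K2 \<or> M = K3"
proof (rule ccontr)
  assume "\<not> ?thesis"
  moreover have "M \<inter> X \<subseteq> K1 \<union> K2 \<union> K3" using assms(2) missing_covers[OF assms(3)] by blast
  ultimately have "card (M \<inter> X) \<le> 3"
    using card_cover_three[of M K1 K2 K3 "M \<inter> X"] maxl_line missing_lines[OF assms(3)] assms(1) by auto
  then show False using assms by (simp add: maxl_def)
qed

lemma missing_max:
  assumes "maxl M" "A \<in> X" "A \<notin> M"
  obtains K L where "missing A M K L"
proof -
  obtain K1 K2 K3 where m: "missing A K1 K2 K3" using missing_obtain assms by blast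
  with maxl_in_missing assms show ?thesis using that missing_swap by metis
qed

text \<open>Without a common node the two lines hold eight nodes, and a line through the remaining
  two completes a forbidden cover of \<open>X\<close>.\<close>

lemma maxl_meet:
  assumes "maxl M" "maxl N" "M \<noteq> N"
  obtains v where "v \<in> X" "M \<inter> N = {v}"
proof -
  have "M \<inter> N \<inter> X \<noteq> {}"
  proof
    assume "M \<inter> N \<inter> X = {}"
    then have "card (M \<inter> X \<union> N \<inter> X) = 8"
      using assms by (subst card_Un_disjoint) (auto simp: maxl_def)
    then have "card (X - (M \<inter> X \<union> N \<inter> X)) = 2"
      using card_X by (subst card_Diff_subset) auto
    then obtain p q where pq: "X - (M \<inter> X \<union> N \<inter> X) = {p, q}" by (auto simp: card_2_iff)
    obtain K where "line K" "p \<in> K" "q \<in> K" using line_through by blast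
    moreover have "X \<subseteq> M \<union> N \<union> K" using pq calculation by (auto simp: set_eq_iff)
    ultimately show False using not_covered assms maxl_line by blast
  qed
  then obtain v where "v \<in> M" "v \<in> N" "v \<in> X" by blast
  then show ?thesis using that line_unique assms maxl_line by blast
qed

lemma card_compl_two_max:
  assumes "maxl M" "maxl N" "M \<noteq> N"
  shows "card (X - (M \<union> N)) = 3"
proof -
  obtain v where v: "v \<in> X" "M \<inter> N = {v}" using maxl_meet assms by blast
  have "(M \<inter> X) \<inter> (N \<inter> X) = {v}" using v by blast
  then have "card (M \<inter> X \<union> N \<inter> X) = 7"
    using card_Un_Int[of "M \<inter> X" "N \<inter> X"] assms by (auto simp: maxl_def)
  then have "card (X - (M \<inter> X \<union> N \<inter> X)) = 3"
    using card_X by (subst card_Diff_subset) auto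
  moreover have "X - (M \<inter> X \<union> N \<inter> X) = X - (M \<union> N)" by blast
  ultimately show ?thesis by simp
qed

text \<open>Three maximal lines through one point would hold 1 + 3 * 3 = 10 nodes and so cover
  \<open>X\<close>.\<close>

lemma maxl_not_concurrent:
  assumes "maxl M" "maxl N" "maxl P" "M \<noteq> N" "M \<noteq> P" "N \<noteq> P"
  shows "M \<inter> N \<inter> P = {}"
proof (rule ccontr)
  assume "\<not> ?thesis"
  then obtain v where v: "v \<in> M" "v \<in> N" "v \<in> P" by blast
  obtain a where a: "a \<in> X" "M \<inter> N = {a}" using maxl_meet assms by blast
  obtain b where b: "b \<in> X" "M \<inter> P = {b}" using maxl_meet assms by blast
  obtain c where c: "c \<in> X" "N \<inter> P = {c}" using maxl_meet assms by blast
  have e: "v \<in> X" "M \<inter> P = {v}" "N \<inter> P = {v}" using v a b c by auto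
  then have "P \<inter> X - {v} \<subseteq> X - (M \<union> N)" by blast
  moreover have "card (P \<inter> X - {v}) = 3" using assms e v by (simp add: maxl_def)
  ultimately have "P \<inter> X - {v} = X - (M \<union> N)"
    using card_compl_two_max[OF assms(1,2,4)] by (intro card_subset_eq) auto
  then have "X \<subseteq> M \<union> N \<union> P" by blast
  then show False using not_covered assms maxl_line by blast
qed

text \<open>The private nodes of \<open>M\<close>, those on neither of the other two lines: four
  nodes minus two vertices, which differ because the lines are not concurrent.\<close>

lemma card_private:
  assumes "maxl M" "maxl N" "maxl P" "M \<noteq> N" "M \<noteq> P" "N \<noteq> P"
  shows "card (M \<inter> X - (N \<union> P)) = 2"
proof -
  obtain a where a: "a \<in> X" "M \<inter> N = {a}" using maxl_meet assms by blast
  obtain b where b: "b \<in> X" "M \<inter> P = {b}" using maxl_meet assms by blast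
  have "a \<noteq> b" using maxl_not_concurrent[OF assms] a b by blast
  moreover have "M \<inter> X - (N \<union> P) = M \<inter> X - {a, b}" using a b by blast
  moreover have "a \<in> M" "b \<in> M" using a b by auto
  ultimately show ?thesis using assms a b by (simp add: maxl_def card_Diff_subset)
qed

lemma compl_three_max:
  assumes "maxl M" "maxl N" "maxl P" "M \<noteq> N" "M \<noteq> P" "N \<noteq> P"
  obtains Z where "X - (M \<union> N \<union> P) = {Z}"
proof -
  have "card (P \<inter> X - (M \<union> N)) = 2" using card_private assms by metis
  then have "card (X - (M \<union> N) - (P \<inter> X - (M \<union> N))) = 1"
    using card_compl_two_max[OF assms(1,2,4)] by (subst card_Diff_subset) auto
  moreover have "X - (M \<union> N) - (P \<inter> X - (M \<union> N)) = X - (M \<union> N \<union> P)" by blast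
  ultimately show ?thesis using that by (auto simp: card_1_singleton_iff)
qed


section \<open>Existence of three maximal lines\<close>

text \<open>Three lines with at most three nodes each have to cover nine nodes, so every bound is
  attained and no node is counted twice. The claims for the other lines follow by
  \<open>missing_swap\<close>.\<close>

lemma missing_partition:
  assumes "missing A K L M" "card (K \<inter> X) \<le> 3" "card (L \<inter> X) \<le> 3" "card (M \<inter> X) \<le> 3"
  shows "card (K \<inter> X) = 3" "K \<inter> L \<inter> X = {}"
proof -
  have A: "A \<in> X" using missing_node[OF assms(1)] by simp
  have "K \<inter> X \<union> L \<inter> X \<union> M \<inter> X = X - {A}"
    using missing_node[OF assms(1)] missing_covers[OF assms(1)] by blast
  then have 9: "card (K \<inter> X \<union> L \<inter> X \<union> M \<inter> X) = 9" using A card_X by simp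
  have "card (K \<inter> X) + card (L \<inter> X) = card (K \<inter> X \<union> L \<inter> X) + card (K \<inter> X \<inter> (L \<inter> X))"
    by (rule card_Un_Int) auto
  moreover have "card (K \<inter> X \<union> L \<inter> X \<union> M \<inter> X) \<le> card (K \<inter> X \<union> L \<inter> X) + card (M \<inter> X)"
    by (rule card_Un_le)
  ultimately have *: "card (K \<inter> X) = 3" "card (K \<inter> X \<inter> (L \<inter> X)) = 0" using 9 assms by linarith+
  then show "card (K \<inter> X) = 3" by simp
  show "K \<inter> L \<inter> X = {}" using *(2) by auto
qed

text \<open>By \<open>missing_partition\<close> the lines \<open>K\<close>, \<open>L1\<close>,
  \<open>L2\<close> partition \<open>X - {A}\<close>; by symmetry let \<open>B\<close> lie on
  \<open>L1\<close>. The three nodes of \<open>L2\<close> are off \<open>K\<close> and differ from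
  \<open>B\<close>, so \<open>M1\<close> and \<open>M2\<close> cover them and one of these, say
  \<open>M1\<close>, equals \<open>L2\<close>. The two nodes of \<open>L1\<close> other than
  \<open>B\<close> are then left to \<open>M2\<close>, which gives \<open>L1 = M2\<close>, although
  \<open>M2\<close> misses \<open>B\<close>.\<close>

lemma used_by_one:
  assumes le: "\<And>K. line K \<Longrightarrow> card (K \<inter> X) \<le> 3"
    and A: "missing A K L1 L2" and B: "missing B K M1 M2"
  shows "A = B"
proof (rule ccontr)
  assume "A \<noteq> B"
  have parts: "card (K' \<inter> X) = 3" "card (L' \<inter> X) = 3" "K' \<inter> L' \<inter> X = {}" if "missing C K' L' M'" for C K' L' M'
    using missing_partition[OF that] missing_partition[OF missing_swap(1)[OF that]] le missing_lines[OF that]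
    by auto
  have False if A: "missing A K L1 L2" and "B \<in> L1" for L1 L2
  proof -
    have A': "missing A K L2 L1" "missing A L1 L2 K" using A missing_swap by metis+
    have d: "K \<inter> L1 \<inter> X = {}" "K \<inter> L2 \<inter> X = {}" "L1 \<inter> L2 \<inter> X = {}" "card (L1 \<inter> X) = 3" "card (L2 \<inter> X) = 3"
      using parts[OF A] parts[OF A'(1)] parts[OF A'(2)] by auto
    have BX: "B \<in> X" using missing_node[OF B] by simp
    have *: False if B: "missing B K M1 M2" and "L2 = M1" for M1 M2
    proof -
      have "L1 \<inter> X - {B} \<subseteq> M2" using missing_covers[OF B] d that by blast
      moreover have "card (L1 \<inter> X - {B}) = 2" using d BX \<open>B \<in> L1\<close> by simp
      ultimately have "L1 = M2"
        using card_inter_le[of L1 M2 "L1 \<inter> X - {B}"] missing_lines[OF A] missing_lines[OF B] by fastforce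
      then show False using \<open>B \<in> L1\<close> missing_node[OF B] by blast
    qed
    have "L2 \<inter> X \<subseteq> M1 \<union> M2" using missing_covers[OF B] d BX \<open>B \<in> L1\<close> by blast
    then have "L2 = M1 \<or> L2 = M2"
      using card_cover_two[of L2 M1 M2 "L2 \<inter> X"] d missing_lines[OF A] missing_lines[OF B] by auto
    then show False using *[OF B] *[OF missing_swap(2)[OF B]] by blast
  qed
  moreover have "B \<in> L1 \<or> B \<in> L2"
    using missing_covers[OF A] missing_node[OF B] \<open>A \<noteq> B\<close> by blast
  ultimately show False using A missing_swap by blast
qed

text \<open>Without a maximal line, the nine lines through a node \<open>P\<close> that are used by the other nodes
  are distinct 3-node lines; outside \<open>P\<close> they would need 18 nodes.\<close>

lemma exists_max: "\<exists>M. maxl M"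
proof (rule ccontr)
  assume no: "\<not> ?thesis"
  have le: "card (K \<inter> X) \<le> 3" if "line K" for K
  proof -
    have "card (K \<inter> X) \<noteq> 4" using no that by (auto simp: maxl_def)
    then show ?thesis using card_line_le[OF that] by linarith
  qed
  obtain P where P: "P \<in> X" using card_X by fastforce
  have "\<exists>K. P \<in> K \<and> (\<exists>L M. missing A K L M)" if "A \<in> X - {P}" for A
  proof -
    have "A \<in> X" using that by simp
    then obtain K L M where m: "missing A K L M" by (rule missing_obtain)
    then have "P \<in> K \<or> P \<in> L \<or> P \<in> M" using missing_covers P that by blast
    then show ?thesis using m missing_swap by metis
  qed
  then obtain f where f: "\<And>A. A \<in> X - {P} \<Longrightarrow> P \<in> f A \<and> (\<exists>L M. missing A (f A) L M)" by metis
  have c: "card (f A \<inter> X - {P}) = 2" if A: "A \<in> X - {P}" for A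
  proof -
    obtain L M where m: "missing A (f A) L M" using f[OF A] by blast
    then have "card (f A \<inter> X) = 3" using missing_partition(1)[OF m] le missing_lines[OF m] by blast
    then show ?thesis using f[OF A] P by simp
  qed
  have "card (\<Union>A\<in>X - {P}. f A \<inter> X - {P}) = (\<Sum>A\<in>X - {P}. card (f A \<inter> X - {P}))"
  proof (rule card_UN_disjoint)
    show "\<forall>A\<in>X - {P}. \<forall>B\<in>X - {P}. A \<noteq> B \<longrightarrow> (f A \<inter> X - {P}) \<inter> (f B \<inter> X - {P}) = {}"
    proof (intro ballI impI, rule ccontr)
      fix A B assume AB: "A \<in> X - {P}" "B \<in> X - {P}" "A \<noteq> B" "(f A \<inter> X - {P}) \<inter> (f B \<inter> X - {P}) \<noteq> {}"
      \<comment> \<open>A common node besides \<open>P\<close> makes the two lines equal, and one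
        line has only one user here.\<close>
      then obtain q where "q \<in> f A" "q \<in> f B" "q \<noteq> P" by blast
      then have "f A = f B" using f[OF AB(1)] f[OF AB(2)] line_unique missing_lines by metis
      then show False using used_by_one[OF le] f[OF AB(1)] f[OF AB(2)] AB(3) by metis
    qed
  qed auto
  also have "\<dots> = 18" using c P card_X by simp
  finally have "card (\<Union>A\<in>X - {P}. f A \<inter> X - {P}) = 18" .
  moreover have "card (\<Union>A\<in>X - {P}. f A \<inter> X - {P}) \<le> card X" by (rule card_mono) auto
  ultimately show False using card_X by simp
qed

text \<open>If \<open>M\<close> is the only maximal line, the six nodes off it contain two 3-node
  lines \<open>N1\<close>, \<open>N2\<close> with a common node \<open>v\<close>, and a single node
  \<open>w\<close> is off both. Every node \<open>C\<close> of \<open>M\<close> then forces the line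
  through \<open>v\<close> and \<open>w\<close> to contain a node of \<open>M\<close> other than
  \<open>C\<close>. Using this for two choices of \<open>C\<close> puts two nodes of
  \<open>M\<close> on that line, which would thus be \<open>M\<close>.\<close>

lemma exists_second:
  assumes M: "maxl M" shows "\<exists>N. maxl N \<and> N \<noteq> M"
proof (rule ccontr)
  assume no: "\<not> ?thesis"
  have le: "card (K \<inter> X) \<le> 3" if "line K" "K \<noteq> M" for K
  proof -
    have "card (K \<inter> X) \<noteq> 4" using no that by (auto simp: maxl_def)
    then show ?thesis using card_line_le[OF that(1)] by linarith
  qed
  define Y where "Y = X - M"
  have "card (X - M \<inter> X) = 6" using M card_X by (subst card_Diff_subset) (auto simp: maxl_def)
  moreover have "X - M \<inter> X = Y" by (auto simp: Y_def)
  ultimately have cY: "card Y = 6" by simp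
  have fY [simp]: "finite Y" by (simp add: Y_def)
  \<comment> \<open>\<open>A\<close> uses \<open>M\<close>, so two further lines share the five
    other nodes of \<open>Y\<close>, and one of them has three. As a line other than
    \<open>M\<close> it has no further node, hence none on \<open>M\<close>.\<close>
  have three: "\<exists>K. line K \<and> A \<notin> K \<and> card (K \<inter> Y) = 3 \<and> K \<inter> X \<subseteq> Y" if "A \<in> Y" for A
  proof -
    have "\<exists>K. line K \<and> A \<notin> K \<and> card (K \<inter> Y) \<ge> 3"
    proof -
      have "A \<in> X" "A \<notin> M" using that by (auto simp: Y_def)
      then obtain K L where m: "missing A M K L" by (rule missing_max[OF M])
      have "Y - {A} \<subseteq> (K \<inter> Y) \<union> (L \<inter> Y)" using missing_covers[OF m] by (auto simp: Y_def)
      then have "card (Y - {A}) \<le> card ((K \<inter> Y) \<union> (L \<inter> Y))" by (intro card_mono) auto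
      also have "\<dots> \<le> card (K \<inter> Y) + card (L \<inter> Y)" by (rule card_Un_le)
      finally have "5 \<le> card (K \<inter> Y) + card (L \<inter> Y)" using cY that by simp
      then have "3 \<le> card (K \<inter> Y) \<or> 3 \<le> card (L \<inter> Y)" by linarith
      then show ?thesis using missing_lines[OF m] missing_node[OF m] by blast
    qed
    then obtain K where K: "line K" "A \<notin> K" "card (K \<inter> Y) \<ge> 3" by blast
    have "M \<inter> Y = {}" by (auto simp: Y_def)
    then have "K \<noteq> M" using K by auto
    then have "card (K \<inter> X) \<le> 3" using le K by blast
    moreover have "K \<inter> Y \<subseteq> K \<inter> X" by (auto simp: Y_def)
    ultimately have "K \<inter> Y = K \<inter> X" using K(3) card_mono[of "K \<inter> X" "K \<inter> Y"] by (intro card_subset_eq) auto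
    then show ?thesis using K \<open>card (K \<inter> X) \<le> 3\<close> by (intro exI[of _ K]) auto
  qed
  obtain A where "A \<in> Y" using cY by fastforce
  then obtain N1 where N1: "line N1" "card (N1 \<inter> Y) = 3" "N1 \<inter> X \<subseteq> Y" using three by blast
  then obtain B where B: "B \<in> N1" "B \<in> Y" by (metis IntE card.empty all_not_in_conv zero_neq_numeral)
  then obtain N2 where N2: "line N2" "B \<notin> N2" "card (N2 \<inter> Y) = 3" "N2 \<inter> X \<subseteq> Y" using three by blast
  \<comment> \<open>Two disjoint triples would exhaust \<open>Y\<close>, and \<open>M\<close>,
    \<open>N1\<close>, \<open>N2\<close> would cover \<open>X\<close>.\<close>
  have "N1 \<inter> N2 \<inter> Y \<noteq> {}"
  proof
    assume "N1 \<inter> N2 \<inter> Y = {}"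
    then have "card (N1 \<inter> Y \<union> N2 \<inter> Y) = 6" using N1 N2 by (subst card_Un_disjoint) auto
    then have "N1 \<inter> Y \<union> N2 \<inter> Y = Y" using cY by (intro card_subset_eq) auto
    then have "X \<subseteq> M \<union> N1 \<union> N2" by (auto simp: Y_def)
    then show False using not_covered M maxl_line N1 N2 by blast
  qed
  then obtain v where v: "v \<in> N1" "v \<in> N2" "v \<in> Y" by blast
  then have "(N1 \<inter> Y) \<inter> (N2 \<inter> Y) = {v}" using line_unique[of N1 N2 v] N1 N2 B by blast
  then have "card (N1 \<inter> Y \<union> N2 \<inter> Y) = 5" using card_Un_Int[of "N1 \<inter> Y" "N2 \<inter> Y"] N1 N2 by auto
  then have "card (Y - (N1 \<inter> Y \<union> N2 \<inter> Y)) = 1" using cY by (subst card_Diff_subset) auto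
  then obtain w where w: "Y - (N1 \<inter> Y \<union> N2 \<inter> Y) = {w}" by (auto simp: card_1_singleton_iff)
  have key: "\<exists>t m. line t \<and> v \<in> t \<and> w \<in> t \<and> m \<in> t \<and> m \<in> M \<and> m \<in> X \<and> m \<noteq> C" if C: "C \<in> M" "C \<in> X" for C
  proof -
    have vX: "v \<in> X" "v \<noteq> C" "v \<notin> M" using v C by (auto simp: Y_def)
    obtain K1 K2 K3 where m: "missing C K1 K2 K3" and "v \<in> K1"
      using missing_obtain[OF C(2)] missing_covers[of C _ _ _ v] vX missing_swap by metis
    have ne: "K1 \<noteq> M" "K2 \<noteq> M" "K3 \<noteq> M" using missing_node[OF m] C by auto
    then have c3: "card (K1 \<inter> X) = 3" using missing_partition(1)[OF m] le missing_lines[OF m] by blast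
    \<comment> \<open>Three nodes of \<open>M\<close> besides \<open>C\<close> need covering, and
      \<open>K2\<close> and \<open>K3\<close> take at most one each.\<close>
    have "K1 \<inter> M \<inter> X \<noteq> {}"
    proof
      assume "K1 \<inter> M \<inter> X = {}"
      then have "M \<inter> X - {C} \<subseteq> K2 \<union> K3" using missing_covers[OF m] by blast
      then have "card (M \<inter> X - {C}) \<le> 2"
        using card_cover_two[of M K2 K3 "M \<inter> X - {C}"] ne missing_lines[OF m] M maxl_line by auto
      then show False using M C by (simp add: maxl_def)
    qed
    then obtain n where n: "n \<in> K1" "n \<in> M" "n \<in> X" by blast
    have "card (K1 \<inter> X - {v, n}) = 1"
      using n \<open>v \<in> K1\<close> vX c3 by (subst card_Diff_subset) (auto simp: card_insert_if)
    then obtain y where "y \<in> K1 \<inter> X - {v, n}" by (auto simp: card_1_singleton_iff)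
    then have y: "y \<in> K1" "y \<in> X" "y \<noteq> v" "y \<noteq> n" by auto
    \<comment> \<open>The third node of \<open>K1\<close> cannot lie on \<open>M\<close>, else
      \<open>K1 = M\<close> because of \<open>n\<close>. Nor can it lie on \<open>N1\<close> or
      \<open>N2\<close>, else \<open>K1\<close> would equal that line because of \<open>v\<close>,
      but those lines have no node on \<open>M\<close>. Only \<open>w\<close> is left.\<close>
    have "y \<notin> M" using line_unique[of K1 M n y] y n ne missing_lines[OF m] M maxl_line by blast
    moreover have "n \<notin> N1" "n \<notin> N2" using n N1 N2 by (auto simp: Y_def)
    then have "y \<notin> N1" "y \<notin> N2"
      using line_unique[of K1 _ v y] y v n \<open>v \<in> K1\<close> missing_lines(1)[OF m] N1 N2 by metis+
    ultimately have "y \<in> Y - (N1 \<inter> Y \<union> N2 \<inter> Y)" using y by (auto simp: Y_def)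
    then have "y = w" using w by blast
    then show ?thesis using \<open>v \<in> K1\<close> y n missing_lines[OF m] missing_node[OF m] by blast
  qed
  have "M \<inter> X \<noteq> {}" using M unfolding maxl_def by (metis card.empty zero_neq_numeral)
  then obtain C where "C \<in> M \<inter> X" by blast
  then obtain t m where t: "line t" "v \<in> t" "w \<in> t" "m \<in> t" "m \<in> M" "m \<in> X" using key by blast
  \<comment> \<open>\<open>key\<close> is now applied to the node \<open>m\<close> that its first
    application produced.\<close>
  then obtain t' m' where t': "line t'" "v \<in> t'" "w \<in> t'" "m' \<in> t'" "m' \<in> M" "m' \<noteq> m" using key by metis
  have "v \<noteq> w" using v w by blast
  then have "t = t'" using t t' line_unique by blast
  then have "t = M" using t t' line_unique[of t M m m'] M maxl_line by blast
  then show False using v t by (auto simp: Y_def)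
qed

text \<open>\<open>p\<close> uses \<open>N\<close>, and the two remaining lines share the three
  nodes off \<open>M\<close> and \<open>N\<close>, so one of them, \<open>K\<close>, has two. The
  other one misses \<open>p\<close>, hence is not \<open>M\<close>, and cannot take both of the
  remaining nodes of \<open>M\<close> off \<open>N\<close>; one of these is therefore on
  \<open>K\<close>.\<close>

lemma node_on_side:
  assumes M: "maxl M" and N: "maxl N" and "M \<noteq> N" and p: "p \<in> M \<inter> X - N"
  shows "\<exists>p' K. p' \<in> M \<inter> X - N \<and> p' \<noteq> p \<and> line K \<and> p' \<in> K \<and> 2 \<le> card (K \<inter> (X - (M \<union> N)))"
proof -
  define Z where "Z = X - (M \<union> N)"
  have cZ: "card Z = 3" using card_compl_two_max assms by (simp add: Z_def)
  have fZ [simp]: "finite Z" by (simp add: Z_def)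
  obtain v where v: "v \<in> X" "M \<inter> N = {v}" using maxl_meet assms by blast
  have "p \<in> X" "p \<notin> N" using p by auto
  then obtain K L where m: "missing p N K L" by (rule missing_max[OF N])
  have "Z \<subseteq> (K \<inter> Z) \<union> (L \<inter> Z)" using missing_covers[OF m] p by (auto simp: Z_def)
  then have "card Z \<le> card ((K \<inter> Z) \<union> (L \<inter> Z))" by (intro card_mono) auto
  also have "\<dots> \<le> card (K \<inter> Z) + card (L \<inter> Z)" by (rule card_Un_le)
  finally have "2 \<le> card (K \<inter> Z) \<or> 2 \<le> card (L \<inter> Z)" using cZ by linarith
  then obtain K L where m: "missing p N K L" and K: "2 \<le> card (K \<inter> Z)" using m missing_swap by blast
  have "v \<noteq> p" "v \<in> M" "M \<inter> X - N = M \<inter> X - {v}" using v p by auto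
  then have "card (M \<inter> X - N - {p}) = 2" using M p v by (simp add: maxl_def)
  moreover have "L \<noteq> M" using missing_node[OF m] p by blast
  ultimately have "\<not> M \<inter> X - N - {p} \<subseteq> L"
    using card_inter_le[of M L "M \<inter> X - N - {p}"] M maxl_line missing_lines[OF m] by fastforce
  then obtain p' where "p' \<in> M \<inter> X - N" "p' \<noteq> p" "p' \<in> K" using missing_covers[OF m] by blast
  then show ?thesis using K missing_lines[OF m] unfolding Z_def by blast
qed

text \<open>The three nodes off two maximal lines form a triangle. Each of the two maximal lines has two
  nodes on the sides of the triangle, so some side contains two of these four nodes.\<close>

lemma exists_third:
  assumes M: "maxl M" and N: "maxl N" and "M \<noteq> N"
  shows "\<exists>P. maxl P \<and> P \<noteq> M \<and> P \<noteq> N"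
proof -
  define Z where "Z = X - (M \<union> N)"
  have cZ: "card Z = 3" using card_compl_two_max assms by (simp add: Z_def)
  have fZ [simp]: "finite Z" by (simp add: Z_def)
  have two: "\<exists>p p' K K'. p \<in> M \<inter> X - N \<and> p' \<in> M \<inter> X - N \<and> p' \<noteq> p \<and> line K \<and> p \<in> K \<and> 2 \<le> card (K \<inter> Z)
     \<and> line K' \<and> p' \<in> K' \<and> 2 \<le> card (K' \<inter> Z) \<and> K \<noteq> K'"
    if M: "maxl M" and N: "maxl N" and ne: "M \<noteq> N" and Z: "Z = X - (M \<union> N)" for M N
  proof -
    obtain v where v: "v \<in> X" "M \<inter> N = {v}" using maxl_meet M N ne by blast
    have "v \<in> M" using v by blast
    then have "card (M \<inter> X - {v}) = 3" using M v by (simp add: maxl_def)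
    moreover have "M \<inter> X - N = M \<inter> X - {v}" using v by blast
    ultimately have "M \<inter> X - N \<noteq> {}" by (metis card.empty zero_neq_numeral)
    then obtain p0 where "p0 \<in> M \<inter> X - N" by blast
    \<comment> \<open>The start \<open>p0\<close> is arbitrary. Applying \<open>node_on_side\<close>
      again to its own result \<open>p\<close> gives a node different from \<open>p\<close>.\<close>
    then obtain p K where p: "p \<in> M \<inter> X - N" "line K" "p \<in> K" "2 \<le> card (K \<inter> Z)"
      using node_on_side[OF M N ne] Z by metis
    then obtain p' K' where p': "p' \<in> M \<inter> X - N" "line K'" "p' \<in> K'" "2 \<le> card (K' \<inter> Z)" "p' \<noteq> p"
      using node_on_side[OF M N ne] Z by metis
    have "M \<inter> Z = {}" using Z by blast
    then have "K \<noteq> M" using p by auto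
    then have "K \<noteq> K'" using line_unique[of K M p p'] p p' M maxl_line by blast
    then show ?thesis using p p' by blast
  qed
  obtain p1 p2 K1 K2 where p: "p1 \<in> M \<inter> X - N" "p2 \<in> M \<inter> X - N" "line K1" "line K2" "p1 \<in> K1" "p2 \<in> K2"
    "2 \<le> card (K1 \<inter> Z)" "2 \<le> card (K2 \<inter> Z)" "K1 \<noteq> K2"
    using two[OF assms Z_def] by blast
  have "Z = X - (N \<union> M)" by (auto simp: Z_def)
  then obtain q1 q2 K3 K4 where q: "q1 \<in> N \<inter> X - M" "q2 \<in> N \<inter> X - M" "line K3" "line K4" "q1 \<in> K3" "q2 \<in> K4"
    "2 \<le> card (K3 \<inter> Z)" "2 \<le> card (K4 \<inter> Z)" "K3 \<noteq> K4"
    using two[OF N M] \<open>M \<noteq> N\<close> by blast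
  \<comment> \<open>A line through all of \<open>Z\<close> would cover \<open>X\<close> together
    with \<open>M\<close> and \<open>N\<close>.\<close>
  have side: "card (K \<inter> Z) = 2" if "line K" "2 \<le> card (K \<inter> Z)" for K
  proof -
    have "\<not> Z \<subseteq> K" using not_covered[of M N K] M N maxl_line that by (auto simp: Z_def)
    then have "card (K \<inter> Z) < card Z" by (intro psubset_card_mono) auto
    then show ?thesis using that cZ by simp
  qed
  have inj: "K \<inter> Z \<noteq> K' \<inter> Z" if "line K" "line K'" "2 \<le> card (K \<inter> Z)" "K \<noteq> K'" for K K'
    using card_inter_le[of K K' "K \<inter> Z"] that by fastforce
  have "\<exists>K\<in>{K1, K2}. K \<in> {K3, K4}"
  proof (rule ccontr)
    assume *: "\<not> ?thesis"
    \<comment> \<open>Four different lines would cut four different pairs out of \<open>Z\<close>,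
      which has only three.\<close>
    have "card {K1 \<inter> Z, K2 \<inter> Z, K3 \<inter> Z, K4 \<inter> Z} = 4"
      using inj[of K1 K2] inj[of K1 K3] inj[of K1 K4] inj[of K2 K3] inj[of K2 K4] inj[of K3 K4] p q *
      by (simp add: card_insert_if)
    moreover have "{K1 \<inter> Z, K2 \<inter> Z, K3 \<inter> Z, K4 \<inter> Z} \<subseteq> {S. S \<subseteq> Z \<and> card S = 2}"
      using side p q by auto
    moreover have "card {S. S \<subseteq> Z \<and> card S = 2} = 3" using n_subsets[of Z 2] cZ by (simp add: choose_two)
    moreover have "finite {S. S \<subseteq> Z \<and> card S = 2}" by simp
    ultimately show False
      using card_mono[of "{S. S \<subseteq> Z \<and> card S = 2}" "{K1 \<inter> Z, K2 \<inter> Z, K3 \<inter> Z, K4 \<inter> Z}"] by linarith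
  qed
  then obtain K a b where K: "line K" "2 \<le> card (K \<inter> Z)" "a \<in> K" "a \<in> M \<inter> X - N" "b \<in> K" "b \<in> N \<inter> X - M"
    using p q by blast
  have "card ({a, b} \<union> K \<inter> Z) = card {a, b} + card (K \<inter> Z)"
    using K by (intro card_Un_disjoint) (auto simp: Z_def)
  moreover have "a \<noteq> b" using K by blast
  ultimately have "4 \<le> card ({a, b} \<union> K \<inter> Z)" using K by simp
  also have "\<dots> \<le> card (K \<inter> X)" using K by (intro card_mono) (auto simp: Z_def)
  finally have "maxl K" using card_line_le[OF K(1)] K by (simp add: maxl_def)
  then show ?thesis using K by blast
qed


section \<open>Structure of a configuration with three maximal lines\<close>

text \<open>Such a line exists because the intersection node of \<open>M\<close> and \<open>N\<close> uses \<open>P\<close>, so that two more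
  lines cover its complement in \<open>X - P\<close>.\<close>

lemma line_through_privates:
  assumes "maxl M" "maxl N" "maxl P" "M \<noteq> N" "M \<noteq> P" "N \<noteq> P" and Z: "X - (M \<union> N \<union> P) = {Z}"
  shows "\<exists>K x y. line K \<and> Z \<in> K \<and> x \<in> M \<inter> X - (N \<union> P) \<and> y \<in> N \<inter> X - (M \<union> P) \<and> x \<in> K \<and> y \<in> K"
proof -
  obtain v where v: "v \<in> X" "M \<inter> N = {v}" using maxl_meet assms by blast
  have "v \<notin> P" using maxl_not_concurrent[OF assms(1-6)] v by blast
  with v(1) obtain K L where m: "missing v P K L" by (rule missing_max[OF assms(3)])
  have Z': "Z \<in> X" "Z \<notin> M" "Z \<notin> N" "Z \<notin> P" using Z by blast+
  then have "Z \<in> K \<or> Z \<in> L" using missing_covers[OF m, of Z] v by blast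
  then obtain K L where m: "missing v P K L" and ZK: "Z \<in> K" using m missing_swap by blast
  \<comment> \<open>\<open>L\<close> misses \<open>v\<close>, so it is not \<open>Q\<close> and
    cannot take both private nodes of \<open>Q\<close>; \<open>K\<close> takes one.\<close>
  have in_K: "\<exists>x \<in> Q \<inter> X - (R \<union> P). x \<in> K"
    if Q: "maxl Q" "maxl R" "Q \<noteq> R" "Q \<noteq> P" "R \<noteq> P" "v \<in> Q" "v \<in> R" for Q R
  proof -
    have 2: "card (Q \<inter> X - (R \<union> P)) = 2" using card_private Q assms(3) by blast
    have "L \<noteq> Q" using missing_node[OF m] Q by blast
    then have "\<not> Q \<inter> X - (R \<union> P) \<subseteq> L"
      using card_inter_le[of Q L "Q \<inter> X - (R \<union> P)"] 2 Q maxl_line missing_lines[OF m] by fastforce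
    then show ?thesis using missing_covers[OF m] Q by blast
  qed
  have "\<exists>x \<in> M \<inter> X - (N \<union> P). x \<in> K" "\<exists>x \<in> N \<inter> X - (M \<union> P). x \<in> K"
    using in_K[of M N] in_K[of N M] assms v by blast+
  then show ?thesis using ZK missing_lines[OF m] by blast
qed

text \<open>Each pair of maximal lines yields a line through \<open>Z\<close> joining a private node
  of one to a private node of the other. The digit in a node's name is the index of its maximal
  line, the letters x, y, z belong to \<open>A\<close>, \<open>B\<close>, \<open>C\<close>. The last
  clause holds because a line through \<open>Z\<close> with private nodes of all three would have
  four nodes and be a further maximal line. It also keeps \<open>A\<close>, \<open>B\<close>,
  \<open>C\<close> apart, so the two private nodes named on each maximal line are different.\<close>

lemma three_max_structure:
  assumes max: "maxl M1" "maxl M2" "maxl M3" and ne: "M1 \<noteq> M2" "M1 \<noteq> M3" "M2 \<noteq> M3"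
    and only: "\<And>M. maxl M \<Longrightarrow> M = M1 \<or> M = M2 \<or> M = M3"
  obtains Z x1 y1 x2 z2 y3 z3 A B C
  where "X - (M1 \<union> M2 \<union> M3) = {Z}"
    "M1 \<inter> X - (M2 \<union> M3) = {x1, y1}" "M2 \<inter> X - (M1 \<union> M3) = {x2, z2}" "M3 \<inter> X - (M1 \<union> M2) = {y3, z3}"
    "line A" "line B" "line C" "Z \<in> A" "Z \<in> B" "Z \<in> C"
    "x1 \<in> A" "x2 \<in> A" "y1 \<in> B" "y3 \<in> B" "z2 \<in> C" "z3 \<in> C"
    "\<And>K a b c. \<lbrakk>line K; Z \<in> K; a \<in> {x1, y1}; b \<in> {x2, z2}; c \<in> {y3, z3}\<rbrakk> \<Longrightarrow> \<not> (a \<in> K \<and> b \<in> K \<and> c \<in> K)"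
proof -
  obtain Z where Z: "X - (M1 \<union> M2 \<union> M3) = {Z}" using compl_three_max[OF max ne] by blast
  let ?P1 = "M1 \<inter> X - (M2 \<union> M3)" and ?P2 = "M2 \<inter> X - (M1 \<union> M3)" and ?P3 = "M3 \<inter> X - (M1 \<union> M2)"
  have no4: "\<not> (a \<in> K \<and> b \<in> K \<and> c \<in> K)"
    if K: "line K" "Z \<in> K" "a \<in> ?P1" "b \<in> ?P2" "c \<in> ?P3" for K a b c
  proof
    assume abc: "a \<in> K \<and> b \<in> K \<and> c \<in> K"
    have "Z \<noteq> a" "Z \<noteq> b" "Z \<noteq> c" "a \<noteq> b" "a \<noteq> c" "b \<noteq> c" using K Z by blast+
    then have "4 = card {Z, a, b, c}" by simp
    also have "\<dots> \<le> card (K \<inter> X)" using K Z abc by (intro card_mono) auto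
    finally have "maxl K" using card_line_le[OF K(1)] K by (simp add: maxl_def)
    then show False using only K(2) Z by blast
  qed
  obtain A x1 x2 where A: "line A" "Z \<in> A" "x1 \<in> ?P1" "x2 \<in> ?P2" "x1 \<in> A" "x2 \<in> A"
    using line_through_privates[OF max ne Z] by blast
  have "X - (M1 \<union> M3 \<union> M2) = {Z}" "M1 \<inter> X - (M3 \<union> M2) = ?P1" using Z by blast+
  then obtain B y1 y3 where B: "line B" "Z \<in> B" "y1 \<in> ?P1" "y3 \<in> ?P3" "y1 \<in> B" "y3 \<in> B"
    using line_through_privates[of M1 M3 M2 Z] max ne by metis
  have "X - (M2 \<union> M3 \<union> M1) = {Z}" "M2 \<inter> X - (M3 \<union> M1) = ?P2" "M3 \<inter> X - (M2 \<union> M1) = ?P3" using Z by blast+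
  then obtain C z2 z3 where C: "line C" "Z \<in> C" "z2 \<in> ?P2" "z3 \<in> ?P3" "z2 \<in> C" "z3 \<in> C"
    using line_through_privates[of M2 M3 M1 Z] max ne by metis
  have nZ: "Z \<noteq> x1" "Z \<noteq> x2" "Z \<noteq> y3" using A B Z by blast+
  have "x1 \<noteq> y1" using no4[of A x1 x2 y3] line_unique[of A B Z x1] A B nZ by blast
  moreover have "x2 \<noteq> z2" using no4[of A x1 x2 z3] line_unique[of A C Z x2] A C nZ by blast
  moreover have "y3 \<noteq> z3" using no4[of B y1 z2 y3] line_unique[of B C Z y3] B C nZ by blast
  moreover have "card ?P1 = 2" "card ?P2 = 2" "card ?P3 = 2"
    using card_private[OF max ne] card_private[of M2 M1 M3] card_private[of M3 M1 M2] max ne by auto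
  ultimately have P: "?P1 = {x1, y1}" "?P2 = {x2, z2}" "?P3 = {y3, z3}"
    using A B C card_seteq[of ?P1 "{x1, y1}"] card_seteq[of ?P2 "{x2, z2}"] card_seteq[of ?P3 "{y3, z3}"] by auto
  have "\<not> (a \<in> K \<and> b \<in> K \<and> c \<in> K)" if "line K" "Z \<in> K" "a \<in> {x1, y1}" "b \<in> {x2, z2}" "c \<in> {y3, z3}" for K a b c
    using no4[of K a b c, unfolded P] that by blast
  then show ?thesis
    using that[OF Z P A(1) B(1) C(1) A(2) B(2) C(2) A(5,6) B(5,6) C(5,6)] by blast
qed

end

section \<open>Users of a 3-node line\<close>

locale three_node_line = line_cover +
  fixes L
  assumes line_L: "line L" and card_L: "card (L \<inter> X) = 3"
begin

definition users :: "'a set" where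
  "users = {A \<in> X. used A L}"

lemma not_maxl_L: "\<not> maxl L"
  using card_L by (simp add: maxl_def)

lemma maxl_ne_L: "maxl M \<Longrightarrow> M \<noteq> L"
  using not_maxl_L by blast

lemma maxl_meets_L:
  assumes "maxl M" "M \<inter> L \<inter> X \<noteq> {}"
  obtains A where "A \<in> X" "M \<inter> L = {A}"
proof -
  obtain A where "A \<in> M" "A \<in> L" "A \<in> X" using assms by blast
  then show ?thesis using that line_unique[of M L A] assms maxl_line line_L maxl_ne_L by blast
qed

lemma used_max:
  assumes "used A L" "maxl M" "A \<notin> M"
  obtains K where "missing A L M K"
proof -
  obtain K1 K2 where "missing A L K1 K2" using assms by (auto simp: used_def)
  moreover from this have "M = K1 \<or> M = K2" using maxl_in_missing assms maxl_ne_L by blast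
  ultimately show ?thesis using that missing_swap by blast
qed

text \<open>Three nodes are off \<open>L\<close> and \<open>M\<close>, and they are not collinear
  since \<open>L\<close>, \<open>M\<close> and a third line cannot cover \<open>X\<close>. Hence
  each of them is missed by \<open>L\<close>, \<open>M\<close> and the line through the other two. A
  user on \<open>M\<close> is impossible: \<open>L\<close> takes no node of \<open>M\<close>, so two
  lines would have to take its other three.\<close>

lemma users_disjoint_max:
  assumes M: "maxl M" and d: "M \<inter> L \<inter> X = {}"
  shows "users = X - (L \<union> M)" "card users = 3"
    "line K \<Longrightarrow> \<not> users \<subseteq> K"
    "\<lbrakk>maxl N; N \<noteq> M\<rbrakk> \<Longrightarrow> (\<exists>A\<in>X. N \<inter> L = {A}) \<and> card (N \<inter> users) = 2"
proof -
  let ?Z = "X - (L \<union> M)"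
  have nc: "\<not> ?Z \<subseteq> K" if "line K" for K
    using not_covered[OF line_L maxl_line[OF M] that] by blast
  have "card (L \<inter> X \<union> M \<inter> X) = 7"
    using M d card_L by (subst card_Un_disjoint) (auto simp: maxl_def)
  then have "card (X - (L \<inter> X \<union> M \<inter> X)) = 3" using card_X by (subst card_Diff_subset) auto
  moreover have "X - (L \<inter> X \<union> M \<inter> X) = ?Z" by blast
  ultimately have cZ: "card ?Z = 3" by simp
  have "A \<in> users" if A: "A \<in> ?Z" for A
  proof -
    have "card (?Z - {A}) = 2" using cZ A by simp
    then obtain p q where pq: "?Z - {A} = {p, q}" by (auto simp: card_2_iff)
    obtain K where K: "line K" "p \<in> K" "q \<in> K" using line_through by blast
    have sub: "?Z - {A} \<subseteq> K" using pq K by simp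
    moreover have "A \<notin> K" using nc[OF K(1)] sub by blast
    ultimately have "X - (L \<union> M \<union> K) = {A}" using A by blast
    then have "missing A L M K" using K line_L maxl_line[OF M] by (simp add: missing_def)
    then show ?thesis using A by (auto simp: users_def used_def)
  qed
  moreover have "A \<notin> M" if u: "used A L" for A
  proof
    assume "A \<in> M"
    obtain K1 K2 where m: "missing A L K1 K2" using u by (auto simp: used_def)
    have "M \<inter> X - {A} \<subseteq> K1 \<union> K2" using missing_covers[OF m] d by blast
    then have "card (M \<inter> X - {A}) \<le> 2"
      using card_cover_two[of M K1 K2 "M \<inter> X - {A}"] missing_lines[OF m] missing_node[OF m] M maxl_line \<open>A \<in> M\<close> by auto
    then show False using M \<open>A \<in> M\<close> missing_node[OF m] by (simp add: maxl_def)
  qed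
  moreover have "A \<notin> L" if "used A L" for A
    using that missing_node by (auto simp: used_def)
  ultimately show U: "users = ?Z" unfolding users_def by blast
  then show cU: "card users = 3" using cZ by simp
  show nU: "\<not> users \<subseteq> K" if "line K" for K using nc that U by simp
  show "(\<exists>A\<in>X. N \<inter> L = {A}) \<and> card (N \<inter> users) = 2" if N: "maxl N" "N \<noteq> M"
  proof -
    have fU: "finite users" using U by simp
    have "card (N \<inter> users) < card users"
      using nU[OF maxl_line[OF N(1)]] fU by (intro psubset_card_mono) auto
    then have 2: "card (N \<inter> users) \<le> 2" using cU by simp
    have 1: "card (N \<inter> L \<inter> X) \<le> 1" "card (N \<inter> M \<inter> X) \<le> 1"
      using card_inter_le[of N L "N \<inter> L \<inter> X"] card_inter_le[of N M "N \<inter> M \<inter> X"]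
        N maxl_line M line_L maxl_ne_L by auto
    have "(N \<inter> users) \<union> (N \<inter> L \<inter> X) \<union> (N \<inter> M \<inter> X) = N \<inter> X" using U by blast
    then have "4 \<le> card (N \<inter> users) + card (N \<inter> L \<inter> X) + card (N \<inter> M \<inter> X)"
      using card_Un_le[of "(N \<inter> users) \<union> (N \<inter> L \<inter> X)" "N \<inter> M \<inter> X"]
        card_Un_le[of "N \<inter> users" "N \<inter> L \<inter> X"] N by (simp add: maxl_def)
    then have "card (N \<inter> users) = 2" "card (N \<inter> L \<inter> X) = 1" using 1 2 by linarith+
    moreover from this have "N \<inter> L \<inter> X \<noteq> {}" by auto
    ultimately show ?thesis using maxl_meets_L[OF N(1)] by blast
  qed
qed

text \<open>Of the three nodes off \<open>M\<close> and \<open>N\<close>, two lie on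
  \<open>L\<close>, which meets both lines only at \<open>v\<close>. The remaining node is missed by
  \<open>L\<close>, \<open>M\<close>, \<open>N\<close>. A user on \<open>M\<close> would be off
  \<open>N\<close>, so its lines would be \<open>L\<close>, \<open>N\<close> and some
  \<open>K\<close>; the two nodes of \<open>M\<close> other than the user and \<open>v\<close> would
  put \<open>K = M\<close>, which contains the user.\<close>

lemma users_two_max:
  assumes M: "maxl M" and N: "maxl N" and "M \<noteq> N" and v: "v \<in> X" "M \<inter> N = {v}" "v \<in> L"
  shows "users = X - (L \<union> M \<union> N)" "card users = 1"
proof -
  let ?Z = "X - (L \<union> M \<union> N)"
  have v_only: "P \<inter> L = {v}" if P: "maxl P" "v \<in> P" for P
  proof -
    have "P \<inter> L \<inter> X \<noteq> {}" using P v by blast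
    then obtain a where "P \<inter> L = {a}" by (rule maxl_meets_L[OF P(1)])
    moreover have "v \<in> P \<inter> L" using P v(3) by simp
    ultimately show ?thesis by simp
  qed
  have v_only: "M \<inter> L = {v}" "N \<inter> L = {v}" using v_only[OF M] v_only[OF N] v(2) by auto
  have "card (L \<inter> X - (M \<union> N)) = 2"
  proof -
    have "L \<inter> X - (M \<union> N) = L \<inter> X - {v}" using v_only by blast
    then show ?thesis using card_L v by simp
  qed
  then have "card (X - (M \<union> N) - (L \<inter> X - (M \<union> N))) = 1"
    using card_compl_two_max[OF M N \<open>M \<noteq> N\<close>] by (subst card_Diff_subset) auto
  moreover have "X - (M \<union> N) - (L \<inter> X - (M \<union> N)) = ?Z" by blast
  ultimately have cZ: "card ?Z = 1" by simp
  have not_in: "A \<notin> P"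
    if P: "maxl P" "maxl Q" "P \<noteq> Q" "P \<inter> Q = {v}" "P \<inter> L = {v}" and u: "used A L" for A P Q
  proof
    assume A: "A \<in> P"
    have "A \<notin> L" using u missing_node by (auto simp: used_def)
    then have "A \<noteq> v" "A \<notin> Q" using v A P by auto
    then obtain K where m: "missing A L Q K" using used_max[OF u P(2)] by blast
    have "P \<inter> X - {A, v} \<subseteq> K" using missing_covers[OF m] P by blast
    moreover have "v \<in> P" using P by blast
    then have "card (P \<inter> X - {A, v}) = 2"
      using P A \<open>A \<noteq> v\<close> v missing_node[OF m] by (simp add: maxl_def card_Diff_subset)
    ultimately have "P = K"
      using card_inter_le[of P K "P \<inter> X - {A, v}"] P maxl_line missing_lines[OF m] by fastforce
    then show False using A missing_node[OF m] by blast
  qed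
  have "A \<notin> L \<and> A \<notin> M \<and> A \<notin> N" if "used A L" for A
    using that not_in[of M N A] not_in[of N M A] M N \<open>M \<noteq> N\<close> v v_only missing_node by (auto simp: used_def)
  moreover have "A \<in> users" if "A \<in> ?Z" for A
  proof -
    obtain B where "?Z = {B}" using cZ by (auto simp: card_1_singleton_iff)
    then have "?Z = {A}" using that by simp
    then have "missing A L M N" using line_L M N maxl_line by (auto simp: missing_def)
    then show ?thesis using that by (auto simp: users_def used_def)
  qed
  ultimately show "users = ?Z" unfolding users_def by blast
  then show "card users = 1" using cZ by simp
qed

text \<open>A vertex \<open>v\<close> using \<open>L\<close> would be missed by \<open>L\<close>,
  \<open>M3\<close> and a line \<open>K\<close>. Then \<open>K\<close> contains \<open>Z\<close> and
  every private node of \<open>M1\<close> and \<open>M2\<close> that is not on \<open>L\<close>. If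
  \<open>a1\<close> is \<open>x1\<close>, this makes \<open>K\<close> the line \<open>B\<close> and
  adds \<open>x2\<close> to it, against the last clause of \<open>three_max_structure\<close>. If
  \<open>a1\<close> is \<open>y1\<close>, it makes \<open>K\<close> the line \<open>A\<close> with
  the two nodes \<open>x2\<close>, \<open>z2\<close> of \<open>M2\<close>, so \<open>K = M2\<close>
  contains \<open>v\<close>.\<close>

lemma vertex_not_user:
  assumes max: "maxl M1" "maxl M2" "maxl M3" and ne: "M1 \<noteq> M2" "M1 \<noteq> M3" "M2 \<noteq> M3"
    and only: "\<And>M. maxl M \<Longrightarrow> M = M1 \<or> M = M2 \<or> M = M3"
    and a: "a1 \<in> X" "a2 \<in> X" "a3 \<in> X" "M1 \<inter> L = {a1}" "M2 \<inter> L = {a2}" "M3 \<inter> L = {a3}"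
    and ne_a: "a1 \<noteq> a2" "a1 \<noteq> a3" "a2 \<noteq> a3"
    and v: "v \<in> M1" "v \<in> M2"
  shows "\<not> used v L"
proof
  assume u: "used v L"
  obtain Z x1 y1 x2 z2 y3 z3 A B C where s: "X - (M1 \<union> M2 \<union> M3) = {Z}"
    "M1 \<inter> X - (M2 \<union> M3) = {x1, y1}" "M2 \<inter> X - (M1 \<union> M3) = {x2, z2}" "M3 \<inter> X - (M1 \<union> M2) = {y3, z3}"
    "line A" "line B" "line C" "Z \<in> A" "Z \<in> B" "Z \<in> C"
    "x1 \<in> A" "x2 \<in> A" "y1 \<in> B" "y3 \<in> B" "z2 \<in> C" "z3 \<in> C"
    and no4: "\<And>K a b c. \<lbrakk>line K; Z \<in> K; a \<in> {x1, y1}; b \<in> {x2, z2}; c \<in> {y3, z3}\<rbrakk> \<Longrightarrow> \<not> (a \<in> K \<and> b \<in> K \<and> c \<in> K)"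
    by (rule three_max_structure[OF max ne], erule only, rule that)
  have v3: "v \<notin> M3" using maxl_not_concurrent[OF max ne] v by blast
  then obtain K where m: "missing v L M3 K" using used_max[OF u max(3)] by blast
  have "{a1, a2, a3} = L \<inter> X" using a ne_a card_L by (intro card_subset_eq) auto
  then have LX: "L \<inter> X = {a1, a2, a3}" by simp
  have L_iff: "t \<in> M1 \<and> t \<in> L \<longleftrightarrow> t = a1" "t \<in> M2 \<and> t \<in> L \<longleftrightarrow> t = a2" "t \<in> M3 \<and> t \<in> L \<longleftrightarrow> t = a3" for t
    using a(4-6) by (simp_all add: set_eq_iff)
  have Z_iff: "t \<in> X \<and> t \<notin> M1 \<and> t \<notin> M2 \<and> t \<notin> M3 \<longleftrightarrow> t = Z" for t
    using s(1) by (simp add: set_eq_iff)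
  have P_iff: "t \<in> M1 \<and> t \<in> X \<and> t \<notin> M2 \<and> t \<notin> M3 \<longleftrightarrow> t = x1 \<or> t = y1"
    "t \<in> M2 \<and> t \<in> X \<and> t \<notin> M1 \<and> t \<notin> M3 \<longleftrightarrow> t = x2 \<or> t = z2"
    "t \<in> M3 \<and> t \<in> X \<and> t \<notin> M1 \<and> t \<notin> M2 \<longleftrightarrow> t = y3 \<or> t = z3" for t
    using s(2-4) by (simp_all add: set_eq_iff)
  have aL: "a1 \<in> L" "a2 \<in> L" "a3 \<in> L" using L_iff by auto
  \<comment> \<open>A node of \<open>L\<close> on two maximal lines would make two of the
    \<open>a1\<close>, \<open>a2\<close>, \<open>a3\<close> equal.\<close>
  have priv: "a1 = x1 \<or> a1 = y1" "a2 = x2 \<or> a2 = z2" "a3 = y3 \<or> a3 = z3"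
    using P_iff L_iff a(1-3) ne_a by metis+
  have ZX: "Z \<in> X" "Z \<notin> M1" "Z \<notin> M2" "Z \<notin> M3" using Z_iff by auto
  have "Z \<noteq> a1" "Z \<noteq> a2" "Z \<noteq> a3" using ZX L_iff by metis+
  then have "Z \<notin> L" using LX ZX by blast
  moreover have "Z \<noteq> v" using ZX v by blast
  ultimately have ZL: "Z \<notin> L" "Z \<in> K" using missing_covers[OF m ZX(1)] ZX by auto
  have PM: "x1 \<in> M1" "y1 \<in> M1" "x2 \<notin> M1" "z2 \<notin> M1" "x2 \<in> M2" "z2 \<in> M2" "x1 \<notin> M2" "y1 \<notin> M2"
    "y3 \<notin> M1" "z3 \<notin> M2" "x1 \<notin> M3" "y1 \<notin> M3" "x2 \<notin> M3" "z2 \<notin> M3" "x1 \<in> X" "y1 \<in> X" "x2 \<in> X" "z2 \<in> X"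
    using P_iff by metis+
  have nZ: "Z \<noteq> x1" "Z \<noteq> y1" "Z \<noteq> x2" "Z \<noteq> z2" using ZX PM by auto
  have in_K: "t \<in> K" if "t = x1 \<or> t = y1 \<or> t = x2 \<or> t = z2" "t \<noteq> a1" "t \<noteq> a2" for t
  proof -
    have t: "t \<in> X" "t \<notin> M3" "t \<noteq> v" using that PM v by blast+
    moreover have "t \<noteq> a3" using t L_iff by blast
    then have "t \<notin> L" using t LX that by blast
    ultimately show ?thesis using missing_covers[OF m] by blast
  qed
  \<comment> \<open>Each pair lies on one of the lines \<open>A\<close>, \<open>B\<close>,
    \<open>C\<close> through \<open>Z\<close>, and \<open>Z\<close> is off \<open>L\<close>.\<close>
  have ncol: "\<not> (x1 \<in> L \<and> x2 \<in> L)" "\<not> (y1 \<in> L \<and> y3 \<in> L)" "\<not> (z2 \<in> L \<and> z3 \<in> L)"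
  proof -
    have "x1 \<noteq> x2" "y1 \<noteq> y3" "z2 \<noteq> z3" using P_iff by metis+
    then show "\<not> (x1 \<in> L \<and> x2 \<in> L)" "\<not> (y1 \<in> L \<and> y3 \<in> L)" "\<not> (z2 \<in> L \<and> z3 \<in> L)"
      using line_unique[OF line_L] s ZL by metis+
  qed
  have "card {x1, y1} = 2" "card {x2, z2} = 2"
    using card_private[OF max ne] card_private[OF max(2,1,3)] ne unfolding s(2,3) by simp_all
  then have 2: "x1 \<noteq> y1" "x2 \<noteq> z2" by auto
  have sep: "x1 \<noteq> a2" "y1 \<noteq> a2" "x2 \<noteq> a1" "z2 \<noteq> a1" using PM L_iff by metis+
  show False
  proof (cases "a1 = x1")
    case True
    \<comment> \<open>The pairing propagates: \<open>x1\<close> on \<open>L\<close> excludes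
      \<open>x2\<close>, so \<open>z2\<close> is on \<open>L\<close>, which in turn excludes
      \<open>z3\<close>.\<close>
    then have "a2 = z2" "a3 = y3" using priv ncol aL by auto
    moreover have KB: "y1 \<in> K" "x2 \<in> K" using in_K sep True 2 \<open>a2 = z2\<close> by auto
    moreover have "K = B" using line_unique[of K B Z y1] KB ZL nZ s(5-14) missing_lines[OF m] by blast
    ultimately show False using no4[of B y1 x2 y3] s(6,9,13,14) by simp
  next
    case False
    then have "a1 = y1" using priv by blast
    then have "a3 = z3" "a2 = x2" using priv ncol aL by auto
    moreover have KA: "x1 \<in> K" "z2 \<in> K" using in_K sep False 2 \<open>a2 = x2\<close> by auto
    moreover have "K = A" using line_unique[of K A Z x1] KA ZL nZ s(5-14) missing_lines[OF m] by blast
    ultimately have "x2 \<in> K" "z2 \<in> K" using s(12) by auto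
    then have "K = M2" using line_unique[of K M2 x2 z2] PM 2 max maxl_line missing_lines[OF m] by blast
    then show False using v missing_node[OF m] by blast
  qed
qed

text \<open>A user other than \<open>Z\<close> that is off two maximal lines would be missed by
  exactly these two and \<open>L\<close>, but they leave \<open>Z\<close> uncovered.
  \<open>Z\<close> itself would need \<open>L\<close> and all three maximal lines among its three
  lines. So a user lies on two maximal lines, and \<open>vertex_not_user\<close> excludes
  that.\<close>

lemma users_three_max:
  assumes max: "maxl M1" "maxl M2" "maxl M3" and ne: "M1 \<noteq> M2" "M1 \<noteq> M3" "M2 \<noteq> M3"
    and only: "\<And>M. maxl M \<Longrightarrow> M = M1 \<or> M = M2 \<or> M = M3"
    and a: "a1 \<in> X" "a2 \<in> X" "a3 \<in> X" "M1 \<inter> L = {a1}" "M2 \<inter> L = {a2}" "M3 \<inter> L = {a3}"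
    and ne_a: "a1 \<noteq> a2" "a1 \<noteq> a3" "a2 \<noteq> a3"
  shows "users = {}"
proof -
  obtain Z where Z: "X - (M1 \<union> M2 \<union> M3) = {Z}" using compl_three_max[OF max ne] by blast
  have "{a1, a2, a3} = L \<inter> X" using a ne_a card_L by (intro card_subset_eq) auto
  then have LX: "L \<inter> X = {a1, a2, a3}" by simp
  have Z': "Z \<in> X" "Z \<notin> M1" "Z \<notin> M2" "Z \<notin> M3" using Z by blast+
  then have "Z \<notin> L" using LX a by blast
  have on_two: "A \<in> P \<or> A \<in> Q"
    if u: "used A L" and P: "maxl P" "maxl Q" "P \<noteq> Q" "Z \<notin> P" "Z \<notin> Q" "A \<noteq> Z" for A P Q
  proof (rule ccontr)
    assume n: "\<not> ?thesis"
    obtain K where m: "missing A L P K" using used_max[OF u P(1)] n by blast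
    then have "Q = K" using maxl_in_missing[OF P(2) _ m] n P maxl_ne_L by blast
    then show False using missing_covers[OF m, of Z] Z' P \<open>Z \<notin> L\<close> by blast
  qed
  have "\<not> used A L" for A
  proof
    assume u: "used A L"
    have "A \<noteq> Z"
    proof
      assume "A = Z"
      then obtain K where m: "missing Z L M1 K" using used_max[of Z M1] u max Z' by blast
      then show False using maxl_in_missing[OF max(2) _ m] maxl_in_missing[OF max(3) _ m] Z' ne max maxl_ne_L by blast
    qed
    then have "A \<in> M1 \<or> A \<in> M2" "A \<in> M1 \<or> A \<in> M3" "A \<in> M2 \<or> A \<in> M3"
      using on_two[OF u] max ne Z' by blast+
    then consider "A \<in> M1" "A \<in> M2" | "A \<in> M1" "A \<in> M3" | "A \<in> M2" "A \<in> M3" by blast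
    then show False
    proof cases
      case 1
      then show ?thesis using vertex_not_user[OF max ne only a ne_a] u by blast
    next
      case 2
      then show ?thesis
        using vertex_not_user[of M1 M3 M2 a1 a3 a2 A] max ne only a ne_a u by blast
    next
      case 3
      then show ?thesis
        using vertex_not_user[of M2 M3 M1 a2 a3 a1 A] max ne only a ne_a u by blast
    qed
  qed
  then show ?thesis by (simp add: users_def)
qed

text \<open>If \<open>v\<close> is on \<open>L\<close>, the two other nodes of \<open>L\<close> are
  among \<open>Z\<close>, \<open>y3\<close>, \<open>z3\<close>, and not both on \<open>M3\<close>.
  So \<open>L\<close> joins \<open>Z\<close> to \<open>y3\<close> or \<open>z3\<close> and is
  \<open>B\<close> or \<open>C\<close>. Then it meets \<open>M1\<close> at \<open>y1\<close> or
  \<open>M2\<close> at \<open>z2\<close>, a second point besides \<open>v\<close>.\<close>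

lemma three_max_vertex_not_on_L:
  assumes max: "maxl M1" "maxl M2" "maxl M3" and ne: "M1 \<noteq> M2" "M1 \<noteq> M3" "M2 \<noteq> M3"
    and only: "\<And>M. maxl M \<Longrightarrow> M = M1 \<or> M = M2 \<or> M = M3"
    and v: "v \<in> M1" "v \<in> M2" "v \<in> X"
  shows "v \<notin> L"
proof
  assume "v \<in> L"
  obtain Z x1 y1 x2 z2 y3 z3 A B C where s: "X - (M1 \<union> M2 \<union> M3) = {Z}"
    "M1 \<inter> X - (M2 \<union> M3) = {x1, y1}" "M2 \<inter> X - (M1 \<union> M3) = {x2, z2}" "M3 \<inter> X - (M1 \<union> M2) = {y3, z3}"
    "line A" "line B" "line C" "Z \<in> A" "Z \<in> B" "Z \<in> C"
    "x1 \<in> A" "x2 \<in> A" "y1 \<in> B" "y3 \<in> B" "z2 \<in> C" "z3 \<in> C"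
    by (rule three_max_structure[OF max ne], erule only, rule that)
  have L12: "L \<inter> M1 \<subseteq> {v}" "L \<inter> M2 \<subseteq> {v}"
    using line_unique[OF line_L maxl_line[OF max(1)], of v] line_unique[OF line_L maxl_line[OF max(2)], of v]
      \<open>v \<in> L\<close> v max maxl_ne_L by blast+
  have "L \<inter> X - {v} \<subseteq> {Z} \<union> {y3, z3}" using L12 s(1,4) by blast
  moreover have c: "card (L \<inter> X - {v}) = 2" using card_L \<open>v \<in> L\<close> v by simp
  moreover have "\<not> L \<inter> X - {v} \<subseteq> M3"
    using card_inter_le[OF line_L maxl_line[OF max(3)], of "L \<inter> X - {v}"] c max maxl_ne_L by fastforce
  moreover have "\<not> L \<inter> X - {v} \<subseteq> {Z}" using c card_mono[of "{Z}" "L \<inter> X - {v}"] by auto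
  moreover have "y3 \<in> M3" "z3 \<in> M3" using s by blast+
  ultimately have "Z \<in> L" "y3 \<in> L \<or> z3 \<in> L" by blast+
  moreover have "Z \<noteq> y3" "Z \<noteq> z3" using s by blast+
  ultimately have "L = B \<or> L = C" using line_unique[OF line_L] s by metis
  then have "y1 \<in> L \<or> z2 \<in> L" using s by blast
  moreover have "y1 \<in> M1" "y1 \<noteq> v" "z2 \<in> M2" "z2 \<noteq> v" using s v by blast+
  ultimately show False using L12 by blast
qed

lemma three_max_exist:
  obtains M1 M2 M3 where "maxl M1" "maxl M2" "maxl M3" "M1 \<noteq> M2" "M1 \<noteq> M3" "M2 \<noteq> M3"
proof -
  obtain M where M: "maxl M" using exists_max by blast
  then obtain N where N: "maxl N" "N \<noteq> M" using exists_second by blast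
  then obtain P where "maxl P" "P \<noteq> M" "P \<noteq> N" using exists_third M by metis
  then show ?thesis using that[of M N P] M N by simp
qed

text \<open>If the first two cases fail, the maximal lines meet \<open>L\<close> at pairwise
  different nodes, and \<open>L\<close> has only three; together with \<open>three_max_exist\<close>
  there are exactly three. Exclusivity is not part of the statement and comes later from the numbers
  of users.\<close>

lemma trichotomy:
  obtains (disjoint) M where "maxl M" "M \<inter> L \<inter> X = {}"
  | (concurrent) M N v where "maxl M" "maxl N" "M \<noteq> N" "v \<in> X" "M \<inter> N = {v}" "v \<in> L"
  | (separate) M1 M2 M3 a1 a2 a3 where "M1 \<noteq> M2" "M1 \<noteq> M3" "M2 \<noteq> M3" "{M. maxl M} = {M1, M2, M3}"
      "a1 \<in> X" "a2 \<in> X" "a3 \<in> X" "a1 \<noteq> a2" "a1 \<noteq> a3" "a2 \<noteq> a3"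
      "M1 \<inter> L = {a1}" "M2 \<inter> L = {a2}" "M3 \<inter> L = {a3}"
proof (cases "(\<exists>M. maxl M \<and> M \<inter> L \<inter> X = {}) \<or>
    (\<exists>M N v. maxl M \<and> maxl N \<and> M \<noteq> N \<and> v \<in> X \<and> M \<inter> N = {v} \<and> v \<in> L)")
  case True
  then show ?thesis using disjoint concurrent by blast
next
  case False
  then have nd: "\<And>M. maxl M \<Longrightarrow> M \<inter> L \<inter> X \<noteq> {}"
    and nc: "\<And>M N v. \<lbrakk>maxl M; maxl N; M \<noteq> N; v \<in> X; M \<inter> N = {v}\<rbrakk> \<Longrightarrow> v \<notin> L" by blast+
  have meet: "\<exists>a\<in>X. M \<inter> L = {a}" if "maxl M" for M
    using maxl_meets_L[OF that nd[OF that]] by blast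
  have diff: "a \<noteq> b" if MN: "maxl M" "maxl N" "M \<noteq> N" "M \<inter> L = {a}" "N \<inter> L = {b}" for M N a b
  proof
    assume "a = b"
    obtain v where v: "v \<in> X" "M \<inter> N = {v}" using maxl_meet[OF MN(1-3)] by blast
    have "a \<in> M \<inter> L" "a \<in> N \<inter> L" using MN(4,5) \<open>a = b\<close> by simp_all
    then have "a \<in> M \<inter> N" "a \<in> L" by auto
    then show False using nc[OF MN(1-3) v] v(2) by simp
  qed
  obtain M1 M2 M3 where M: "maxl M1" "maxl M2" "maxl M3" "M1 \<noteq> M2" "M1 \<noteq> M3" "M2 \<noteq> M3"
    by (rule three_max_exist)
  obtain a1 a2 a3 where a: "a1 \<in> X" "a2 \<in> X" "a3 \<in> X" "M1 \<inter> L = {a1}" "M2 \<inter> L = {a2}" "M3 \<inter> L = {a3}"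
    using meet M by metis
  have ne: "a1 \<noteq> a2" "a1 \<noteq> a3" "a2 \<noteq> a3" using diff M a by metis+
  have "N = M1 \<or> N = M2 \<or> N = M3" if N: "maxl N" for N
  proof (rule ccontr)
    assume n: "\<not> ?thesis"
    obtain b where b: "b \<in> X" "N \<inter> L = {b}" using meet[OF N] by blast
    have "b \<noteq> a1" "b \<noteq> a2" "b \<noteq> a3" using diff N M n a b by metis+
    then have "4 = card {b, a1, a2, a3}" using ne by simp
    also have "\<dots> \<le> card (L \<inter> X)" using a b by (intro card_mono) auto
    finally show False using card_L by simp
  qed
  then have "{M. maxl M} = {M1, M2, M3}" using M by blast
  then show ?thesis using separate[OF M(4-6) _ a(1-3) ne a(4-6)] by simp
qed

lemma card_users_cases:
  "\<lbrakk>maxl M; M \<inter> L \<inter> X = {}\<rbrakk> \<Longrightarrow> card users = 3"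
  "\<lbrakk>maxl M; maxl N; M \<noteq> N; A \<in> X; M \<inter> N = {A}; A \<in> L\<rbrakk> \<Longrightarrow> card users = 1"
  "\<lbrakk>M1 \<noteq> M2; M1 \<noteq> M3; M2 \<noteq> M3; {M. maxl M} = {M1, M2, M3};
    a1 \<in> X; a2 \<in> X; a3 \<in> X; a1 \<noteq> a2; a1 \<noteq> a3; a2 \<noteq> a3;
    M1 \<inter> L = {a1}; M2 \<inter> L = {a2}; M3 \<inter> L = {a3}\<rbrakk> \<Longrightarrow> card users = 0"
proof -
  show "card users = 3" if "maxl M" "M \<inter> L \<inter> X = {}"
    using users_disjoint_max(2)[OF that] .
  show "card users = 1" if "maxl M" "maxl N" "M \<noteq> N" "A \<in> X" "M \<inter> N = {A}" "A \<in> L"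
    using users_two_max(2)[OF that] .
  show "card users = 0" if M: "M1 \<noteq> M2" "M1 \<noteq> M3" "M2 \<noteq> M3" "{M. maxl M} = {M1, M2, M3}"
    and a: "a1 \<in> X" "a2 \<in> X" "a3 \<in> X" "a1 \<noteq> a2" "a1 \<noteq> a3" "a2 \<noteq> a3"
      "M1 \<inter> L = {a1}" "M2 \<inter> L = {a2}" "M3 \<inter> L = {a3}"
  proof -
    have *: "maxl M \<longleftrightarrow> M = M1 \<or> M = M2 \<or> M = M3" for M using M(4) by (simp add: set_eq_iff)
    have "users = {}"
      by (rule users_three_max[OF _ _ _ M(1-3) _ a(1-3,7-9,4-6)]) (simp_all add: *)
    then show ?thesis by simp
  qed
qed

text \<open>Only the concurrent case gives one user, and \<open>three_max_vertex_not_on_L\<close>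
  rules it out.\<close>

lemma card_users_exactly_three_max:
  assumes three: "card {M. maxl M} = 3" shows "card users = 3 \<or> card users = 0"
proof (cases rule: trichotomy)
  case (disjoint M)
  then show ?thesis using card_users_cases(1) by blast
next
  case (concurrent M N v)
  have fin: "finite {M. maxl M}" using three card.infinite by fastforce
  have "card ({M. maxl M} - {M, N}) = 1"
    using three concurrent fin by (simp add: card_Diff_subset)
  then obtain P where "{M. maxl M} - {M, N} = {P}" by (auto simp: card_1_singleton_iff)
  then have P: "maxl Q \<and> Q \<noteq> M \<and> Q \<noteq> N \<longleftrightarrow> Q = P" for Q by (simp add: set_eq_iff)
  have "v \<in> M \<inter> N" using concurrent by simp
  then have "v \<notin> L"
    using three_max_vertex_not_on_L[OF concurrent(1,2) _ concurrent(3)] P concurrent(4) by (metis IntD1 IntD2)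
  then show ?thesis using concurrent by simp
next
  case (separate M1 M2 M3 a1 a2 a3)
  then show ?thesis using card_users_cases(3)[OF separate] by simp
qed

end

section \<open>Bivariate polynomials and poised sets\<close>

lemma bipoly_0_iff: "p \<in> bipoly 0 \<longleftrightarrow> (\<exists>a. p = (\<lambda>_. a))"
  by (auto simp: bipoly_def fun_eq_iff)

lemma bipoly_1_iff: "p \<in> bipoly 1 \<longleftrightarrow> (\<exists>a b c. p = (\<lambda>(x, y). a + b * x + c * y))"
proof
  assume "p \<in> bipoly 1"
  then obtain d where "p = (\<lambda>(x, y). \<Sum>i\<le>1. \<Sum>j\<le>1 - i. d i j * x ^ i * y ^ j)"
    by (auto simp: bipoly_def)
  then have "p = (\<lambda>(x, y). d 0 0 + d 1 0 * x + d 0 1 * y)" by (auto simp: fun_eq_iff)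
  then show "\<exists>a b c. p = (\<lambda>(x, y). a + b * x + c * y)" by blast
next
  assume "\<exists>a b c. p = (\<lambda>(x, y). a + b * x + c * y)"
  then obtain a b c where p: "p = (\<lambda>(x, y). a + b * x + c * y)" by blast
  define d :: "nat \<Rightarrow> nat \<Rightarrow> real" where "d = (\<lambda>i j. if i = 0 then if j = 0 then a else c else b)"
  have "p = (\<lambda>(x, y). \<Sum>i\<le>1. \<Sum>j\<le>1 - i. d i j * x ^ i * y ^ j)"
    by (auto simp: p d_def fun_eq_iff)
  then show "p \<in> bipoly 1" by (auto simp: bipoly_def)
qed

lemma linear_polys_iff:
  "p \<in> linear_polys \<longleftrightarrow> (\<exists>a b c. p = (\<lambda>(x, y). a + b * x + c * y) \<and> (b, c) \<noteq> (0, 0))"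
proof -
  have "(\<lambda>(x, y). a + b * x + c * y) \<in> bipoly 0 \<longleftrightarrow> (b, c) = (0, 0)" for a b c
  proof
    assume "(\<lambda>(x, y). a + b * x + c * y) \<in> bipoly 0"
    then obtain d where d: "(\<lambda>(x, y). a + b * x + c * y) = (\<lambda>_. d)" by (auto simp: bipoly_0_iff)
    show "(b, c) = (0, 0)" using fun_cong[OF d, of "(0, 0)"] fun_cong[OF d, of "(1, 0)"] fun_cong[OF d, of "(0, 1)"] by simp
  qed (auto simp: bipoly_0_iff)
  then show ?thesis unfolding linear_polys_def bipoly_1_iff Diff_iff by blast
qed

lemma linear_polys_bipoly: "l \<in> linear_polys \<Longrightarrow> l \<in> bipoly 1"
  by (simp add: linear_polys_def)

lemma linear_polys_scale:
  assumes "l \<in> linear_polys" "c \<noteq> 0" shows "(\<lambda>z. c * l z) \<in> linear_polys"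
proof -
  obtain a b d where l: "l = (\<lambda>(x, y). a + b * x + d * y)" "(b, d) \<noteq> (0, 0)"
    using assms linear_polys_iff by blast
  have "(\<lambda>z. c * l z) = (\<lambda>(x, y). c * a + (c * b) * x + (c * d) * y)" by (auto simp: l fun_eq_iff algebra_simps)
  moreover have "(c * b, c * d) \<noteq> (0, 0)" using l assms by auto
  ultimately show ?thesis using linear_polys_iff by blast
qed

lemma bipoly_add:
  assumes "p \<in> bipoly n" "q \<in> bipoly n" shows "(\<lambda>z. p z + q z) \<in> bipoly n"
proof -
  obtain c d where "p = (\<lambda>(x, y). \<Sum>i\<le>n. \<Sum>j\<le>n - i. c i j * x ^ i * y ^ j)"
    "q = (\<lambda>(x, y). \<Sum>i\<le>n. \<Sum>j\<le>n - i. d i j * x ^ i * y ^ j)"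
    using assms by (auto simp: bipoly_def)
  then have "(\<lambda>z. p z + q z) = (\<lambda>(x, y). \<Sum>i\<le>n. \<Sum>j\<le>n - i. (c i j + d i j) * x ^ i * y ^ j)"
    by (auto simp: fun_eq_iff distrib_right sum.distrib)
  then show ?thesis by (auto simp: bipoly_def)
qed

lemma bipoly_scale:
  assumes "p \<in> bipoly n" shows "(\<lambda>z. a * p z) \<in> bipoly n"
proof -
  obtain c where "p = (\<lambda>(x, y). \<Sum>i\<le>n. \<Sum>j\<le>n - i. c i j * x ^ i * y ^ j)"
    using assms by (auto simp: bipoly_def)
  then have "(\<lambda>z. a * p z) = (\<lambda>(x, y). \<Sum>i\<le>n. \<Sum>j\<le>n - i. (a * c i j) * x ^ i * y ^ j)"
    by (auto simp: fun_eq_iff sum_distrib_left mult.assoc)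
  then show ?thesis by (auto simp: bipoly_def)
qed

lemma bipoly_diff:
  assumes "p \<in> bipoly n" "q \<in> bipoly n" shows "(\<lambda>z. p z - q z) \<in> bipoly n"
  using bipoly_add[OF assms(1) bipoly_scale[OF assms(2), of "- 1"]] by simp

lemma bipoly_zero: "(\<lambda>_. 0) \<in> bipoly n"
  unfolding bipoly_def by (intro CollectI exI[of _ "\<lambda>_ _. 0"]) (simp add: fun_eq_iff)

lemma bipoly_sum: "(\<And>i. i \<in> I \<Longrightarrow> f i \<in> bipoly n) \<Longrightarrow> (\<lambda>z. \<Sum>i\<in>I. f i z) \<in> bipoly n"
  by (induction I rule: infinite_finite_induct) (simp_all add: bipoly_zero bipoly_add)

lemma bipoly_monomial:
  assumes "i + j \<le> n" shows "(\<lambda>(x, y). a * x ^ i * y ^ j) \<in> bipoly n"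
proof -
  define c where "c = (\<lambda>k l. if k = i \<and> l = j then a else 0)"
  have "(\<Sum>k\<le>n. \<Sum>l\<le>n - k. c k l * x ^ k * y ^ l) = a * x ^ i * y ^ j" for x y
  proof -
    have "(\<Sum>l\<le>n - k. c k l * x ^ k * y ^ l) = (if k = i then a * x ^ i * y ^ j else 0)" for k
    proof (cases "k = i")
      case True
      have "(\<Sum>l\<le>n - k. c k l * x ^ k * y ^ l) = (\<Sum>l\<le>n - k. if l = j then a * x ^ i * y ^ j else 0)"
        using True by (intro sum.cong) (auto simp: c_def)
      moreover have "j \<le> n - i" using assms by simp
      ultimately show ?thesis using True by simp
    qed (simp add: c_def)
    then show ?thesis using assms by simp
  qed
  then have "(\<lambda>(x, y). a * x ^ i * y ^ j) = (\<lambda>(x, y). \<Sum>k\<le>n. \<Sum>l\<le>n - k. c k l * x ^ k * y ^ l)"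
    by (simp add: fun_eq_iff)
  then show ?thesis by (auto simp: bipoly_def)
qed

lemma bipoly_mult:
  assumes "p \<in> bipoly m" "q \<in> bipoly n" shows "(\<lambda>z. p z * q z) \<in> bipoly (m + n)"
proof -
  obtain c d where pq: "p = (\<lambda>(x, y). \<Sum>i\<le>m. \<Sum>j\<le>m - i. c i j * x ^ i * y ^ j)"
    "q = (\<lambda>(x, y). \<Sum>i\<le>n. \<Sum>j\<le>n - i. d i j * x ^ i * y ^ j)"
    using assms by (auto simp: bipoly_def)
  have prod_term: "(\<lambda>z. (c i j * fst z ^ i * snd z ^ j) * q z) \<in> bipoly (m + n)" if "i + j \<le> m" for i j
  proof -
    have "(\<lambda>z. (c i j * fst z ^ i * snd z ^ j) * q z) = (\<lambda>z. \<Sum>k\<le>n. \<Sum>l\<le>n - k.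
        (\<lambda>(x, y). (c i j * d k l) * x ^ (i + k) * y ^ (j + l)) z)"
      by (simp add: fun_eq_iff pq sum_distrib_left power_add mult_ac)
    also have "\<dots> \<in> bipoly (m + n)"
      using that by (intro bipoly_sum bipoly_monomial) auto
    finally show ?thesis .
  qed
  have "(\<lambda>z. p z * q z) = (\<lambda>z. \<Sum>i\<le>m. \<Sum>j\<le>m - i. (c i j * fst z ^ i * snd z ^ j) * q z)"
    by (simp add: fun_eq_iff pq(1) sum_distrib_right)
  also have "\<dots> \<in> bipoly (m + n)"
    by (intro bipoly_sum prod_term) auto
  finally show ?thesis .
qed

text \<open>For fixed \<open>y\<close> the sum is a polynomial in \<open>x\<close> that vanishes
  identically, so its coefficients do; these are polynomials in \<open>y\<close>, to which the same
  argument applies.\<close>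

lemma bipoly_eq_0_imp:
  assumes "\<And>x y :: real. (\<Sum>i\<le>n. \<Sum>j\<le>n - i. c i j * x ^ i * y ^ j) = 0" "i + j \<le> n"
  shows "c i j = 0"
proof -
  have "(\<Sum>j\<le>n - i. c i j * y ^ j) = 0" for y
  proof -
    have "(\<Sum>i\<le>n. (\<Sum>j\<le>n - i. c i j * y ^ j) * x ^ i) = 0" for x
      using assms(1)[of x y] by (simp add: sum_distrib_left mult_ac)
    then show ?thesis using polyfun_eq_0[of "\<lambda>i. \<Sum>j\<le>n - i. c i j * y ^ j" n] assms(2) by auto
  qed
  then show ?thesis using polyfun_eq_0[of "c i" "n - i"] assms(2) by auto
qed

section \<open>The number of nodes of a poised set\<close>

text \<open>Gaussian elimination, one equation per induction step. A nonzero \<open>a j k\<close> is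
  the pivot, the unknown \<open>k\<close> is eliminated from the equations in \<open>J\<close>, and
  equation \<open>j\<close> determines its value \<open>t\<close>.\<close>

lemma homogeneous_system_solvable:
  fixes a :: "'j \<Rightarrow> 'i \<Rightarrow> real"
  assumes "finite J" "finite I" "card J < card I"
  shows "\<exists>c. (\<exists>i\<in>I. c i \<noteq> 0) \<and> (\<forall>j\<in>J. (\<Sum>i\<in>I. a j i * c i) = 0)"
  using assms
proof (induction J arbitrary: I a rule: finite_induct)
  case empty
  then have "I \<noteq> {}" by auto
  then show ?case by (intro exI[of _ "\<lambda>_. 1"]) auto
next
  case (insert j J)
  show ?case
  proof (cases "\<forall>i\<in>I. a j i = 0")
    case True
    moreover obtain c where "\<exists>i\<in>I. c i \<noteq> 0" "\<forall>j\<in>J. (\<Sum>i\<in>I. a j i * c i) = 0"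
      using insert.IH[of I a] insert.prems insert.hyps by auto
    ultimately show ?thesis by (intro exI[of _ c]) auto
  next
    case False
    then obtain k where k: "k \<in> I" "a j k \<noteq> 0" by blast
    then have "card J < card (I - {k})" using insert.prems insert.hyps by simp
    then obtain c where c: "\<exists>i\<in>I - {k}. c i \<noteq> 0"
      "\<And>h. h \<in> J \<Longrightarrow> (\<Sum>i\<in>I - {k}. (a h i - a h k * a j i / a j k) * c i) = 0"
      using insert.IH[of "I - {k}" "\<lambda>h i. a h i - a h k * a j i / a j k"] insert.prems(1) by blast
    define t where "t = - (\<Sum>i\<in>I - {k}. a j i * c i) / a j k"
    have "(\<Sum>i\<in>I - {k}. a h i * (c(k := t)) i) = (\<Sum>i\<in>I - {k}. a h i * c i)" for h
      by (rule sum.cong) auto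
    then have split: "(\<Sum>i\<in>I. a h i * (c(k := t)) i) = a h k * t + (\<Sum>i\<in>I - {k}. a h i * c i)" for h
      using sum.remove[OF insert.prems(1) k(1), of "\<lambda>i. a h i * (c(k := t)) i"] by simp
    have "(\<Sum>i\<in>I. a h i * (c(k := t)) i) = 0" if "h \<in> insert j J" for h
    proof (cases "h = j")
      case True
      then show ?thesis using split[of j] k by (simp add: t_def)
    next
      case False
      then have "0 = (\<Sum>i\<in>I - {k}. a h i * c i) - (\<Sum>i\<in>I - {k}. a h k / a j k * (a j i * c i))"
        using c(2)[of h] that by (simp add: sum_subtractf[symmetric] algebra_simps)
      also have "\<dots> = (\<Sum>i\<in>I - {k}. a h i * c i) + a h k * t"
        by (simp add: t_def sum_distrib_left sum_divide_distrib)
      finally show ?thesis using split[of h] by simp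
    qed
    moreover have "\<exists>i\<in>I. (c(k := t)) i \<noteq> 0" using c(1) by auto
    ultimately show ?thesis by (intro exI[of _ "c(k := t)"]) auto
  qed
qed

lemma sum_monomials:
  fixes n :: nat
  shows "(\<Sum>i\<le>n. \<Sum>j\<le>n - i. f i j) = (\<Sum>(i, j)\<in>(SIGMA i:{..n}. {..n - i}). f i j)"
  by (subst sum.Sigma) auto

lemma poised_interpolant:
  assumes "poised n X" shows "\<exists>p\<in>bipoly n. \<forall>A\<in>X. p A = v A"
  using assms unfolding poised_def by blast

lemma poised_eqI:
  assumes X: "poised n X" and p: "p \<in> bipoly n" and q: "q \<in> bipoly n"
    and eq: "\<And>A. A \<in> X \<Longrightarrow> p A = q A"
  shows "p = q"
proof -
  have "\<exists>!r. r \<in> bipoly n \<and> (\<forall>A\<in>X. r A = q A)" using X by (simp add: poised_def)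
  then show ?thesis using p q eq by blast
qed

text \<open>\<open>?I\<close> indexes the monomials. With fewer nodes than monomials, some nonzero
  polynomial vanishes at all nodes, against uniqueness. With more, the evaluations at the nodes
  satisfy a nontrivial linear relation, violated by the polynomial that is 1 at a node with nonzero
  weight and 0 at the others.\<close>

lemma poised_card:
  assumes "poised n X"
  shows "card X = card (SIGMA i:{..n}. {..n - i})" (is "_ = card ?I")
proof (rule ccontr)
  assume "\<not> ?thesis"
  have fin: "finite X" "finite ?I" using assms by (auto simp: poised_def)
  from \<open>\<not> ?thesis\<close> consider "card X < card ?I" | "card ?I < card X" by linarith
  then show False
  proof cases
    case 1
    obtain c where c: "\<exists>ij\<in>?I. c ij \<noteq> 0"
      "\<And>z. z \<in> X \<Longrightarrow> (\<Sum>ij\<in>?I. (fst z ^ fst ij * snd z ^ snd ij) * c ij) = 0"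
      using homogeneous_system_solvable[OF fin 1, of "\<lambda>z ij. fst z ^ fst ij * snd z ^ snd ij"] by auto
    define p where "p = (\<lambda>(x :: real, y). \<Sum>i\<le>n. \<Sum>j\<le>n - i. c (i, j) * x ^ i * y ^ j)"
    have "p \<in> bipoly n" unfolding bipoly_def p_def by (intro CollectI exI[of _ "\<lambda>i j. c (i, j)"]) simp
    moreover have "p z = 0" if "z \<in> X" for z
      using c(2)[OF that] by (cases z) (simp add: p_def sum_monomials case_prod_unfold mult_ac)
    ultimately have "p = (\<lambda>_. 0)"
      using bipoly_zero by (intro poised_eqI[OF assms]) auto
    then have "(\<Sum>i\<le>n. \<Sum>j\<le>n - i. c (i, j) * x ^ i * y ^ j) = 0" for x y
      by (simp add: p_def fun_eq_iff)
    then have "c (i, j) = 0" if "i + j \<le> n" for i j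
      using bipoly_eq_0_imp[of "\<lambda>i j. c (i, j)" n i j] that by simp
    then show False using c(1) by auto
  next
    case 2
    obtain c where c: "\<exists>A\<in>X. c A \<noteq> 0"
      "\<And>i j. (i, j) \<in> ?I \<Longrightarrow> (\<Sum>A\<in>X. (fst A ^ i * snd A ^ j) * c A) = 0"
      using homogeneous_system_solvable[OF fin(2,1) 2, of "\<lambda>ij z. fst z ^ fst ij * snd z ^ snd ij"] by fastforce
    then obtain A where A: "A \<in> X" "c A \<noteq> 0" by blast
    obtain p where p: "p \<in> bipoly n" "\<And>B. B \<in> X \<Longrightarrow> p B = (if B = A then 1 else 0)"
      using poised_interpolant[OF assms, of "\<lambda>B. if B = A then 1 else 0"] by blast
    obtain d where d: "p = (\<lambda>(x, y). \<Sum>i\<le>n. \<Sum>j\<le>n - i. d i j * x ^ i * y ^ j)"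
      using p(1) by (auto simp: bipoly_def)
    have "(\<Sum>B\<in>X. p B * c B) = (\<Sum>B\<in>X. \<Sum>(i, j)\<in>?I. d i j * (fst B ^ i * snd B ^ j * c B))"
      by (simp add: d sum_monomials case_prod_unfold sum_distrib_left mult_ac)
    also have "\<dots> = (\<Sum>(i, j)\<in>?I. d i j * (\<Sum>B\<in>X. fst B ^ i * snd B ^ j * c B))"
      by (subst sum.swap) (simp add: sum_distrib_left case_prod_unfold)
    also have "\<dots> = 0" using c(2) by (intro sum.neutral) auto
    finally have "(\<Sum>B\<in>X. p B * c B) = 0" .
    moreover have "(\<Sum>B\<in>X. p B * c B) = (\<Sum>B\<in>X. if B = A then c A else 0)"
      using p(2) by (intro sum.cong) auto
    ultimately show False using A fin by simp
  qed
qed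

lemma fundamental_poly:
  assumes "poised n X" "A \<in> X"
  shows "fundamental_poly n X A \<in> bipoly n" "fundamental_poly n X A A = 1"
    "B \<in> X \<Longrightarrow> B \<noteq> A \<Longrightarrow> fundamental_poly n X A B = 0"
proof -
  obtain p where p: "p \<in> bipoly n" "\<And>B. B \<in> X \<Longrightarrow> p B = (if B = A then 1 else 0)"
    using poised_interpolant[OF assms(1), of "\<lambda>B. if B = A then 1 else 0"] by blast
  have "fundamental_poly n X A \<in> bipoly n \<and> fundamental_poly n X A A = 1
      \<and> (\<forall>B\<in>X - {A}. fundamental_poly n X A B = 0)"
    unfolding fundamental_poly_def
  proof (rule theI[of _ p])
    show "p \<in> bipoly n \<and> p A = 1 \<and> (\<forall>B\<in>X - {A}. p B = 0)" using p assms by auto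
  next
    fix q assume "q \<in> bipoly n \<and> q A = 1 \<and> (\<forall>B\<in>X - {A}. q B = 0)"
    then show "q = p" using p by (intro poised_eqI[OF assms(1)]) auto
  qed
  then show "fundamental_poly n X A \<in> bipoly n" "fundamental_poly n X A A = 1"
    "B \<in> X \<Longrightarrow> B \<noteq> A \<Longrightarrow> fundamental_poly n X A B = 0" by auto
qed

lemma fundamental_poly_eqI:
  assumes "poised n X" "A \<in> X" "p \<in> bipoly n" "p A = 1" "\<And>B. B \<in> X \<Longrightarrow> B \<noteq> A \<Longrightarrow> p B = 0"
  shows "fundamental_poly n X A = p"
proof (rule poised_eqI[OF assms(1)])
  show "fundamental_poly n X A B = p B" if "B \<in> X" for B
    using fundamental_poly[OF assms(1,2)] assms(4,5) that by (cases "B = A") auto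
qed (use fundamental_poly[OF assms(1,2)] assms in auto)

section \<open>Lines in the real plane\<close>

lemma is_line_iff:
  "is_line L \<longleftrightarrow> (\<exists>a b c. (b, c) \<noteq> (0, 0) \<and> L = {(x, y). a + b * x + c * y = 0})"
proof -
  have Z: "zero_set (\<lambda>(x, y). a + b * x + c * y) = {(x, y). a + b * x + c * y = 0}" for a b c
    by (auto simp: zero_set_def)
  show ?thesis
  proof
    assume "is_line L"
    then obtain l where l: "l \<in> linear_polys" "L = zero_set l" by (auto simp: is_line_def)
    then obtain a b c where "l = (\<lambda>(x, y). a + b * x + c * y)" "(b, c) \<noteq> (0, 0)"
      using linear_polys_iff by blast
    then show "\<exists>a b c. (b, c) \<noteq> (0, 0) \<and> L = {(x, y). a + b * x + c * y = 0}" using Z l by blast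
  next
    assume "\<exists>a b c. (b, c) \<noteq> (0, 0) \<and> L = {(x, y). a + b * x + c * y = 0}"
    then show "is_line L" unfolding is_line_def using Z linear_polys_iff by blast
  qed
qed

lemma is_line_through: "\<exists>K. is_line K \<and> p \<in> K \<and> q \<in> K"
proof (cases "p = q")
  case True
  then show ?thesis unfolding is_line_iff
    by (intro exI[of _ "{(x, y). - fst p + 1 * x + 0 * y = 0}"] conjI exI[of _ "- fst p"] exI[of _ 1] exI[of _ 0])
      (auto simp: case_prod_unfold)
next
  case False
  define b c where "b = snd q - snd p" and "c = fst p - fst q"
  have "(b, c) \<noteq> (0, 0)" using False by (auto simp: b_def c_def prod_eq_iff)
  moreover have "p \<in> {(x, y). - b * fst p - c * snd p + b * x + c * y = 0}" by (simp add: case_prod_unfold)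
  moreover have "q \<in> {(x, y). - b * fst p - c * snd p + b * x + c * y = 0}"
    by (simp add: case_prod_unfold b_def c_def algebra_simps)
  ultimately show ?thesis unfolding is_line_iff by blast
qed

lemma is_line_unique:
  assumes "is_line K" "is_line L" "p \<in> K" "p \<in> L" "q \<in> K" "q \<in> L" "p \<noteq> q"
  shows "K = L"
proof -
  have sub: "L \<subseteq> K" if KL: "is_line K" "is_line L" "p \<in> K" "p \<in> L" "q \<in> K" "q \<in> L" for K L
  proof
    fix z assume "z \<in> L"
    obtain a b c where K: "(b, c) \<noteq> (0, 0)" "K = {(x, y). a + b * x + c * y = 0}"
      using KL(1) by (auto simp: is_line_iff)
    obtain d e f where L: "(e, f) \<noteq> (0, 0)" "L = {(x, y). d + e * x + f * y = 0}"
      using KL(2) by (auto simp: is_line_iff)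
    \<comment> \<open>\<open>(u, v)\<close> is the direction from \<open>p\<close> to
      \<open>q\<close> and \<open>(s, t)\<close> the offset of \<open>z\<close> from
      \<open>p\<close>. Both are orthogonal to the nonzero normal \<open>(e, f)\<close> of
      \<open>L\<close>, hence parallel to each other.\<close>
    define u v where "u = fst q - fst p" and "v = snd q - snd p"
    define s t where "s = fst z - fst p" and "t = snd z - snd p"
    have uv: "u \<noteq> 0 \<or> v \<noteq> 0" using \<open>p \<noteq> q\<close> by (auto simp: u_def v_def prod_eq_iff)
    have "a + b * fst p + c * snd p = 0" "a + b * fst q + c * snd q = 0"
      "d + e * fst p + f * snd p = 0" "d + e * fst q + f * snd q = 0" "d + e * fst z + f * snd z = 0"
      using KL(3-6) K L \<open>z \<in> L\<close> by auto
    then have eqs: "b * u + c * v = 0" "e * u + f * v = 0" "e * s + f * t = 0"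
      and red: "a + b * fst z + c * snd z = b * s + c * t"
      by (auto simp: u_def v_def s_def t_def algebra_simps)
    have "e * (s * v - t * u) = 0" "f * (s * v - t * u) = 0" using eqs by algebra+
    then have "s * v = t * u" using L(1) by auto
    then have "u * (b * s + c * t) = 0" "v * (b * s + c * t) = 0" using eqs by algebra+
    then have "b * s + c * t = 0" using uv by auto
    then show "z \<in> K" using red K by (simp add: case_prod_unfold)
  qed
  show ?thesis using sub[of K L] sub[of L K] assms by blast
qed

lemma infinite_line:
  assumes "is_line L" shows "infinite L"
proof -
  obtain a b c where L: "(b, c) \<noteq> (0, 0)" "L = {(x, y). a + b * x + c * y = 0}"
    using assms by (auto simp: is_line_iff)
  define s where "s = b\<^sup>2 + c\<^sup>2"
  have s: "s \<noteq> 0" using L(1) by (auto simp: s_def)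
  \<comment> \<open>The foot of the perpendicular from the origin plus \<open>t\<close> times the
    direction \<open>(c, - b)\<close>.\<close>
  define f where "f t = (- a * b / s + c * t, - a * c / s - b * t)" for t
  have "f t \<in> L" for t
    using s by (simp add: L(2) f_def field_simps) (simp add: s_def power2_eq_square algebra_simps)
  moreover have "inj f" using L(1) by (auto simp: inj_on_def f_def)
  ultimately show ?thesis
    by (meson finite_subset finite_imageD image_subset_iff infinite_UNIV_char_0)
qed

text \<open>Lines different from \<open>L\<close> would take only finitely many of its infinitely
  many points.\<close>

lemma line_subset_three:
  assumes "is_line L" "is_line K1" "is_line K2" "is_line K3" "L \<subseteq> K1 \<union> K2 \<union> K3"
  shows "L = K1 \<or> L = K2 \<or> L = K3"
proof (rule ccontr)
  assume n: "\<not> ?thesis"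
  have "finite (L \<inter> K)" if K: "is_line K" "L \<noteq> K" for K
  proof (cases "L \<inter> K = {}")
    case False
    then obtain p where "p \<in> L \<inter> K" by blast
    then have "L \<inter> K \<subseteq> {p}" using is_line_unique[OF assms(1) K(1)] K(2) by blast
    then show ?thesis using finite_subset by blast
  qed simp
  then have "finite (L \<inter> K1 \<union> L \<inter> K2 \<union> L \<inter> K3)" using n assms by simp
  moreover have "L = L \<inter> K1 \<union> L \<inter> K2 \<union> L \<inter> K3" using assms(5) by blast
  ultimately show False using infinite_line[OF assms(1)] by simp
qed

text \<open>Otherwise each of the infinitely many vertical lines would be one of the three.\<close>

lemma three_lines_not_UNIV:
  assumes "is_line K1" "is_line K2" "is_line K3"
  shows "K1 \<union> K2 \<union> K3 \<noteq> UNIV"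
proof
  assume U: "K1 \<union> K2 \<union> K3 = UNIV"
  define V where "V t = {(x, y :: real). - t + 1 * x + 0 * y = (0 :: real)}" for t
  have "is_line (V t)" for t unfolding is_line_iff V_def by (intro exI[of _ "- t"] exI[of _ 1] exI[of _ 0]) simp
  then have "V t \<in> {K1, K2, K3}" for t using line_subset_three[of "V t" K1 K2 K3] assms U by auto
  then have "finite (range V)" by (meson finite.emptyI finite.insertI finite_subset image_subset_iff)
  moreover have "inj V"
  proof
    fix s t assume "V s = V t"
    moreover have "(s, 0) \<in> V s" by (simp add: V_def)
    ultimately show "s = t" by (simp add: V_def)
  qed
  ultimately show False using finite_imageD infinite_UNIV_char_0 by blast
qed

section \<open>From \<open>GC 3\<close> sets to line covers\<close>

lemma linear_poly_prod:
  assumes "k \<in> linear_polys" "l \<in> linear_polys" "m \<in> linear_polys"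
  shows "(\<lambda>z. l z * m z) \<in> bipoly 2" "(\<lambda>z. k z * (l z * m z)) \<in> bipoly 3"
proof -
  show "(\<lambda>z. l z * m z) \<in> bipoly 2"
    using bipoly_mult[of l 1 m 1] assms linear_polys_bipoly by (simp add: numeral_2_eq_2)
  then show "(\<lambda>z. k z * (l z * m z)) \<in> bipoly 3"
    using bipoly_mult[of k 1 _ 2] assms linear_polys_bipoly by (simp add: numeral_2_eq_2 numeral_3_eq_3)
qed

text \<open>The product of the three defining polynomials is a cubic vanishing on \<open>X\<close>,
  hence zero, so the three lines would fill the plane.\<close>

lemma poised_3_not_covered:
  assumes "poised 3 X" "is_line K" "is_line L" "is_line M"
  shows "\<not> X \<subseteq> K \<union> L \<union> M"
proof
  assume X: "X \<subseteq> K \<union> L \<union> M"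
  obtain k l m where klm: "k \<in> linear_polys" "l \<in> linear_polys" "m \<in> linear_polys"
    "K = zero_set k" "L = zero_set l" "M = zero_set m"
    using assms by (auto simp: is_line_def)
  have "(\<lambda>z. k z * (l z * m z)) = (\<lambda>_. 0)"
    using X klm by (intro poised_eqI[OF assms(1) linear_poly_prod(2) bipoly_zero]) (auto simp: zero_set_def)
  then have "k z * (l z * m z) = 0" for z by metis
  then have "K \<union> L \<union> M = UNIV" by (auto simp: klm zero_set_def)
  then show False using three_lines_not_UNIV assms by blast
qed

lemma GC_3_factors:
  assumes "GC 3 X" "A \<in> X"
  obtains k l m where "k \<in> linear_polys" "l \<in> linear_polys" "m \<in> linear_polys"
    "fundamental_poly 3 X A = (\<lambda>z. k z * (l z * m z))"
proof -
  obtain f :: "nat \<Rightarrow> point \<Rightarrow> real"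
    where f: "\<And>i. i < 3 \<Longrightarrow> f i \<in> linear_polys" "fundamental_poly 3 X A = (\<lambda>z. \<Prod>i<3. f i z)"
  proof -
    have "\<exists>f :: nat \<Rightarrow> point \<Rightarrow> real. (\<forall>i<3. f i \<in> linear_polys) \<and> fundamental_poly 3 X A = (\<lambda>z. \<Prod>i<3. f i z)"
      using assms by (simp add: GC_def)
    then show ?thesis using that by blast
  qed
  have "fundamental_poly 3 X A = (\<lambda>z. f 0 z * (f 1 z * f 2 z))"
    unfolding f(2) by (simp add: numeral_3_eq_3 numeral_2_eq_2 mult.assoc)
  then show ?thesis using that[of "f 0" "f 1" "f 2"] f(1) by simp
qed

lemma fundamental_poly_zero_lines:
  assumes "poised 3 X" "A \<in> X" "fundamental_poly 3 X A = (\<lambda>z. k z * (l z * m z))"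
  shows "X - (zero_set k \<union> zero_set l \<union> zero_set m) = {A}"
proof -
  have "k A \<noteq> 0" "l A \<noteq> 0" "m A \<noteq> 0" using fundamental_poly(2)[OF assms(1,2)] assms(3) by auto
  moreover have "k B = 0 \<or> l B = 0 \<or> m B = 0" if "B \<in> X" "B \<noteq> A" for B
    using fundamental_poly(3)[OF assms(1,2) that] assms(3) by auto
  ultimately show ?thesis using assms(2) by (auto simp: zero_set_def)
qed

text \<open>Forwards, \<open>L\<close> lies in the zero set of the three linear factors and so is
  the line of one of them by \<open>line_subset_three\<close>; the other two factors give
  \<open>M\<close> and \<open>N\<close>. Backwards, the product of the three line equations,
  normalised at \<open>A\<close>, has the values that characterise the fundamental
  polynomial.\<close>

lemma uses_iff:
  assumes GC: "GC 3 X" and A: "A \<in> X" and L: "is_line L"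
  shows "uses 3 X A L \<longleftrightarrow> (\<exists>M N. is_line M \<and> is_line N \<and> X - (L \<union> M \<union> N) = {A})"
proof
  have X: "poised 3 X" using GC by (simp add: GC_def)
  show "\<exists>M N. is_line M \<and> is_line N \<and> X - (L \<union> M \<union> N) = {A}" if u: "uses 3 X A L"
  proof -
    obtain l q where lq: "L = zero_set l" "fundamental_poly 3 X A = (\<lambda>z. l z * q z)"
      using u by (auto simp: uses_def)
    obtain k1 k2 k3 where k: "k1 \<in> linear_polys" "k2 \<in> linear_polys" "k3 \<in> linear_polys"
      "fundamental_poly 3 X A = (\<lambda>z. k1 z * (k2 z * k3 z))"
      by (rule GC_3_factors[OF GC A])
    let ?K1 = "zero_set k1" and ?K2 = "zero_set k2" and ?K3 = "zero_set k3"
    have lines: "is_line ?K1" "is_line ?K2" "is_line ?K3" using k by (auto simp: is_line_def)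
    have "L \<subseteq> ?K1 \<union> ?K2 \<union> ?K3"
    proof
      fix z assume "z \<in> L"
      then have "k1 z * (k2 z * k3 z) = 0" using fun_cong[OF k(4), of z] lq by (simp add: zero_set_def)
      then show "z \<in> ?K1 \<union> ?K2 \<union> ?K3" by (auto simp: zero_set_def)
    qed
    then consider "L = ?K1" | "L = ?K2" | "L = ?K3" using line_subset_three[OF L lines] by blast
    moreover have "X - (?K1 \<union> ?K2 \<union> ?K3) = {A}" by (rule fundamental_poly_zero_lines[OF X A k(4)])
    ultimately show ?thesis using lines by cases (metis Un_commute Un_assoc)+
  qed
  show "uses 3 X A L" if ex: "\<exists>M N. is_line M \<and> is_line N \<and> X - (L \<union> M \<union> N) = {A}"
  proof -
    obtain M N where MN: "is_line M" "is_line N" "X - (L \<union> M \<union> N) = {A}" using ex by blast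
    obtain l m n where lmn: "l \<in> linear_polys" "m \<in> linear_polys" "n \<in> linear_polys"
      "L = zero_set l" "M = zero_set m" "N = zero_set n"
      using L MN by (auto simp: is_line_def)
    define c where "c = l A * (m A * n A)"
    have "A \<notin> L" "A \<notin> M" "A \<notin> N" using MN(3) by blast+
    then have c: "c \<noteq> 0" by (auto simp: c_def lmn zero_set_def)
    have "B \<in> L \<or> B \<in> M \<or> B \<in> N" if "B \<in> X" "B \<noteq> A" for B using MN(3) that by blast
    then have "fundamental_poly 3 X A = (\<lambda>z. 1 / c * (l z * (m z * n z)))"
      using c linear_poly_prod(2)[OF lmn(1-3)]
      by (intro fundamental_poly_eqI[OF X A] bipoly_scale) (auto simp: c_def lmn zero_set_def)
    also have "\<dots> = (\<lambda>z. l z * (1 / c * (m z * n z)))" by (simp add: fun_eq_iff)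
    finally have "fundamental_poly 3 X A = (\<lambda>z. l z * (1 / c * (m z * n z)))" .
    moreover have "(\<lambda>z. 1 / c * (m z * n z)) \<in> bipoly (3 - 1)"
      using bipoly_scale[OF linear_poly_prod(1)[OF lmn(1-3)], of "1 / c"] by simp
    ultimately show ?thesis
      unfolding uses_def using lmn(1,4) by (intro bexI[of _ l] conjI bexI[of _ "\<lambda>z. 1 / c * (m z * n z)"])
  qed
qed

text \<open>The line through the other two nodes, scaled to 1 at \<open>A\<close>, is a linear
  polynomial vanishing at these nodes, and combinations of the three solve every interpolation
  problem. Uniqueness holds because a polynomial of degree one vanishing on \<open>Y\<close> would
  make \<open>Y\<close> collinear.\<close>

lemma GC_1_noncollinear:
  assumes c: "card Y = 3" and nc: "\<And>K. is_line K \<Longrightarrow> \<not> Y \<subseteq> K"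
  shows "GC 1 Y"
proof -
  have fin: "finite Y" using c card.infinite by fastforce
  have "\<exists>f\<in>linear_polys. f A = 1 \<and> (\<forall>B\<in>Y. B \<noteq> A \<longrightarrow> f B = 0)" if A: "A \<in> Y" for A
  proof -
    have "card (Y - {A}) = 2" using c A by simp
    then obtain p q where pq: "Y - {A} = {p, q}" by (auto simp: card_2_iff)
    obtain K where K: "is_line K" "p \<in> K" "q \<in> K" using is_line_through by blast
    then obtain l where l: "l \<in> linear_polys" "K = zero_set l" by (auto simp: is_line_def)
    have sub: "Y - {A} \<subseteq> K" using pq K by simp
    then have "A \<notin> K" using nc[OF K(1)] by blast
    then have "l A \<noteq> 0" using l by (simp add: zero_set_def)
    moreover have "l B = 0" if "B \<in> Y" "B \<noteq> A" for B using sub that l by (auto simp: zero_set_def)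
    ultimately show ?thesis
      using linear_polys_scale[OF l(1), of "1 / l A"] by (intro bexI[of _ "\<lambda>z. 1 / l A * l z"]) auto
  qed
  then obtain f where f: "\<And>A. A \<in> Y \<Longrightarrow> f A \<in> linear_polys" "\<And>A. A \<in> Y \<Longrightarrow> f A A = 1"
    "\<And>A B. A \<in> Y \<Longrightarrow> B \<in> Y \<Longrightarrow> B \<noteq> A \<Longrightarrow> f A B = 0" by metis
  have zero: "d = (\<lambda>_. 0)" if d: "d \<in> bipoly 1" "\<And>A. A \<in> Y \<Longrightarrow> d A = 0" for d
  proof (cases "d \<in> bipoly 0")
    case True
    then obtain a where a: "d = (\<lambda>_. a)" by (auto simp: bipoly_0_iff)
    have "Y \<noteq> {}" using c by auto
    then obtain A where "A \<in> Y" by blast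
    then show ?thesis using d(2)[of A] a by simp
  next
    case False
    then have "is_line (zero_set d)" using d by (auto simp: is_line_def linear_polys_def)
    moreover have "Y \<subseteq> zero_set d" using d by (auto simp: zero_set_def)
    ultimately show ?thesis using nc by blast
  qed
  have poised: "poised 1 Y"
    unfolding poised_def
  proof (intro conjI allI fin)
    fix v
    show "\<exists>!p. p \<in> bipoly 1 \<and> (\<forall>A\<in>Y. p A = v A)"
    proof
      let ?p = "\<lambda>z. \<Sum>A\<in>Y. v A * f A z"
      have "?p \<in> bipoly 1" by (intro bipoly_sum bipoly_scale linear_polys_bipoly f(1))
      moreover have "?p B = v B" if "B \<in> Y" for B
      proof -
        have "?p B = (\<Sum>A\<in>Y. if A = B then v B else 0)" using f that by (intro sum.cong) auto
        then show ?thesis using that fin by simp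
      qed
      ultimately show "?p \<in> bipoly 1 \<and> (\<forall>A\<in>Y. ?p A = v A)" by blast
      fix q assume q: "q \<in> bipoly 1 \<and> (\<forall>A\<in>Y. q A = v A)"
      then have "(\<lambda>z. q z - ?p z) = (\<lambda>_. 0)"
        using \<open>?p \<in> bipoly 1\<close> \<open>\<And>B. B \<in> Y \<Longrightarrow> ?p B = v B\<close> by (intro zero bipoly_diff) auto
      then show "q = ?p" by (simp add: fun_eq_iff)
    qed
  qed
  moreover have "\<exists>l :: nat \<Rightarrow> point \<Rightarrow> real.
      (\<forall>i<1. l i \<in> linear_polys) \<and> fundamental_poly 1 Y A = (\<lambda>z. \<Prod>i<1. l i z)" if "A \<in> Y" for A
  proof -
    have "fundamental_poly 1 Y A = f A"
      using f that by (intro fundamental_poly_eqI[OF poised that] linear_polys_bipoly) auto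
    then show ?thesis using f(1)[OF that] by (intro exI[of _ "\<lambda>_. f A"]) simp
  qed
  ultimately show ?thesis unfolding GC_def by blast
qed

lemma GC_3_line_cover:
  assumes GC: "GC 3 X" shows "line_cover is_line X"
proof
  have X: "poised 3 X" using GC by (simp add: GC_def)
  show "\<exists>K. is_line K \<and> p \<in> K \<and> q \<in> K" for p q by (rule is_line_through)
  show "K = L" if "is_line K" "is_line L" "p \<in> K" "p \<in> L" "q \<in> K" "q \<in> L" "p \<noteq> q" for K L p q
    using that by (rule is_line_unique)
  have "card (SIGMA i:{..3 :: nat}. {..3 - i}) = 10" by (simp add: numeral_3_eq_3)
  then show "card X = 10" using poised_card[OF X] by simp
  show "\<not> X \<subseteq> K \<union> L \<union> M" if "is_line K" "is_line L" "is_line M" for K L M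
    using poised_3_not_covered[OF X that] .
  show "\<exists>K L M. is_line K \<and> is_line L \<and> is_line M \<and> X - (K \<union> L \<union> M) = {A}" if "A \<in> X" for A
  proof -
    obtain k l m where klm: "k \<in> linear_polys" "l \<in> linear_polys" "m \<in> linear_polys"
      "fundamental_poly 3 X A = (\<lambda>z. k z * (l z * m z))"
      by (rule GC_3_factors[OF GC \<open>A \<in> X\<close>])
    then have "is_line (zero_set k)" "is_line (zero_set l)" "is_line (zero_set m)"
      by (auto simp: is_line_def)
    then show ?thesis using fundamental_poly_zero_lines[OF X \<open>A \<in> X\<close> klm(4)] by blast
  qed
qed

lemma GC_3_three_node_line:
  assumes "GC 3 X" "node_line 3 X L" shows "three_node_line is_line X L"
  using GC_3_line_cover[OF assms(1)] assms(2)
  by (simp add: three_node_line_def three_node_line_axioms_def node_line_def)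

lemma using_nodes_eq_users:
  assumes "GC 3 X" "node_line 3 X L"
  shows "using_nodes 3 X L = three_node_line.users is_line X L"
proof -
  interpret three_node_line is_line X L using assms by (rule GC_3_three_node_line)
  have "uses 3 X A L \<longleftrightarrow> used A L" if "A \<in> X" for A
    using uses_iff[OF assms(1) that line_L] line_L by (auto simp: used_def missing_def)
  then show ?thesis by (auto simp: using_nodes_def users_def)
qed

theorem proposition3p2:
  fixes X L :: "point set"
  assumes "GC 3 X" and "node_line 3 X L"
  shows
    "(card (using_nodes 3 X L) = 3 \<or> card (using_nodes 3 X L) = 1
        \<or> card (using_nodes 3 X L) = 0) \<and>
     (card (using_nodes 3 X L) = 3 \<longleftrightarrow>
        (\<exists>M0. maximal_line 3 X M0 \<and> M0 \<inter> L \<inter> X = {})) \<and>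
     (\<forall>M0. maximal_line 3 X M0 \<and> M0 \<inter> L \<inter> X = {} \<longrightarrow>
        using_nodes 3 X L = X - (L \<union> M0) \<and>
        GC 1 (using_nodes 3 X L) \<and>
        (\<forall>M. maximal_line 3 X M \<and> M \<noteq> M0 \<longrightarrow>
           (\<exists>A\<in>X. M \<inter> L = {A}) \<and> card (M \<inter> using_nodes 3 X L) = 2)) \<and>
     (card (using_nodes 3 X L) = 1 \<longleftrightarrow>
        (\<exists>M' M''. maximal_line 3 X M' \<and> maximal_line 3 X M'' \<and> M' \<noteq> M'' \<and>
           (\<exists>A\<in>X. M' \<inter> M'' = {A} \<and> A \<in> L))) \<and>
     (\<forall>M' M''. maximal_line 3 X M' \<and> maximal_line 3 X M'' \<and> M' \<noteq> M'' \<and>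
           (\<exists>A\<in>X. M' \<inter> M'' = {A} \<and> A \<in> L) \<longrightarrow>
        using_nodes 3 X L = X - (L \<union> M' \<union> M'')) \<and>
     (card (using_nodes 3 X L) = 0 \<longleftrightarrow>
        (\<exists>M1 M2 M3. M1 \<noteq> M2 \<and> M1 \<noteq> M3 \<and> M2 \<noteq> M3 \<and>
           {M. maximal_line 3 X M} = {M1, M2, M3} \<and>
           (\<exists>A1\<in>X. \<exists>A2\<in>X. \<exists>A3\<in>X. A1 \<noteq> A2 \<and> A1 \<noteq> A3 \<and> A2 \<noteq> A3 \<and>
              M1 \<inter> L = {A1} \<and> M2 \<inter> L = {A2} \<and> M3 \<inter> L = {A3}))) \<and>
     (card {M. maximal_line 3 X M} = 3 \<longrightarrow>
        (\<forall>L'. node_line 3 X L' \<longrightarrow>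
           card (using_nodes 3 X L') = 3 \<or> card (using_nodes 3 X L') = 0))"
proof -
  interpret three_node_line is_line X L
    using assms by (rule GC_3_three_node_line)
  have max: "maximal_line 3 X = maxl"
    by (auto simp: fun_eq_iff maximal_line_def node_line_def maxl_def)
  have users: "using_nodes 3 X L = users"
    using using_nodes_eq_users assms .
  define D where "D \<longleftrightarrow> (\<exists>M0. maxl M0 \<and> M0 \<inter> L \<inter> X = {})"
  define C where "C \<longleftrightarrow> (\<exists>M' M''. maxl M' \<and> maxl M'' \<and> M' \<noteq> M'' \<and> (\<exists>A\<in>X. M' \<inter> M'' = {A} \<and> A \<in> L))"
  define S where "S \<longleftrightarrow> (\<exists>M1 M2 M3. M1 \<noteq> M2 \<and> M1 \<noteq> M3 \<and> M2 \<noteq> M3 \<and> {M. maxl M} = {M1, M2, M3} \<and>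
      (\<exists>A1\<in>X. \<exists>A2\<in>X. \<exists>A3\<in>X. A1 \<noteq> A2 \<and> A1 \<noteq> A3 \<and> A2 \<noteq> A3 \<and>
        M1 \<inter> L = {A1} \<and> M2 \<inter> L = {A2} \<and> M3 \<inter> L = {A3}))"
  have D: "card users = 3" if D using that card_users_cases(1) unfolding D_def by blast
  have C: "card users = 1" if C using that card_users_cases(2) unfolding C_def by blast
  have S: "card users = 0" if S
  proof -
    from that obtain M1 M2 M3 A1 A2 A3 where M: "M1 \<noteq> M2" "M1 \<noteq> M3" "M2 \<noteq> M3" "{M. maxl M} = {M1, M2, M3}"
      and A: "A1 \<in> X" "A2 \<in> X" "A3 \<in> X" "A1 \<noteq> A2" "A1 \<noteq> A3" "A2 \<noteq> A3"
        "M1 \<inter> L = {A1}" "M2 \<inter> L = {A2}" "M3 \<inter> L = {A3}"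
      unfolding S_def by (elim exE conjE bexE)
    show ?thesis by (rule card_users_cases(3)[OF M A])
  qed
  have "D \<or> C \<or> S"
  proof (cases rule: trichotomy)
    case (disjoint M)
    then show ?thesis unfolding D_def by blast
  next
    case (concurrent M N v)
    then have C unfolding C_def by (intro exI[of _ M] exI[of _ N] conjI bexI[of _ v])
    then show ?thesis by blast
  next
    case (separate M1 M2 M3 a1 a2 a3)
    then have S unfolding S_def
      by (intro exI[of _ M1] exI[of _ M2] exI[of _ M3] conjI bexI[of _ a1] bexI[of _ a2] bexI[of _ a3])
    then show ?thesis by blast
  qed
  \<comment> \<open>\<open>D\<close>, \<open>C\<close>, \<open>S\<close> are exhaustive and imply
    the different values 3, 1, 0, so each value also implies its case.\<close>
  then have cases: "card users = 3 \<or> card users = 1 \<or> card users = 0"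
    "card users = 3 \<longleftrightarrow> D" "card users = 1 \<longleftrightarrow> C" "card users = 0 \<longleftrightarrow> S"
    using D C S by auto
  have disjoint: "\<forall>M0. maxl M0 \<and> M0 \<inter> L \<inter> X = {} \<longrightarrow> users = X - (L \<union> M0) \<and> GC 1 users \<and>
      (\<forall>M. maxl M \<and> M \<noteq> M0 \<longrightarrow> (\<exists>A\<in>X. M \<inter> L = {A}) \<and> card (M \<inter> users) = 2)"
  proof (intro allI impI conjI)
    fix M0 assume M0: "maxl M0 \<and> M0 \<inter> L \<inter> X = {}"
    note u = users_disjoint_max[of M0]
    show "users = X - (L \<union> M0)" using u(1) M0 by blast
    show "GC 1 users" using u(2,3) M0 by (intro GC_1_noncollinear) auto
    show "\<exists>A\<in>X. M \<inter> L = {A}" "card (M \<inter> users) = 2" if "maxl M \<and> M \<noteq> M0" for M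
      using u(4)[of M] M0 that by auto
  qed
  have concurrent: "\<forall>M' M''. maxl M' \<and> maxl M'' \<and> M' \<noteq> M'' \<and> (\<exists>A\<in>X. M' \<inter> M'' = {A} \<and> A \<in> L)
      \<longrightarrow> users = X - (L \<union> M' \<union> M'')"
    using users_two_max(1) by blast
  \<comment> \<open>The line \<open>L'\<close> is arbitrary, so the locale is instantiated anew;
    \<open>maxl\<close> does not depend on the chosen 3-node line.\<close>
  have other: "card (using_nodes 3 X L') = 3 \<or> card (using_nodes 3 X L') = 0"
    if three: "card {M. maxl M} = 3" and L': "node_line 3 X L'" for L'
    using three_node_line.card_users_exactly_three_max[OF GC_3_three_node_line[OF assms(1) L'] three]
      using_nodes_eq_users[OF assms(1) L'] by simp
  show ?thesis
    unfolding max users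
    by (intro conjI cases(1) cases(2)[unfolded D_def] cases(3)[unfolded C_def] cases(4)[unfolded S_def]
        disjoint concurrent) (intro allI impI other)
qed

end
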